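(* Let $E$ be a finitely or countably generated Hilbert $A$-module over a unital $C^*$-algebra $A$, let $Y=\{y_n\}$ be a standard frame for $E$ with bounds $C$ and $D$, and let $\tilde Y=\{\tilde y_n\}$ be its canonical dual frame. (1) If $X=\{x_n\}\subset E$ is a standard Bessel sequence such that $$\sum_n\|x_n-\tilde y_n\|^2<\frac{1}{4D},$$ then $\mathbf{M}_{I,Y,X}$ is invertible. (2) Let $X=\{x_n\}\subset E$ be a standard Bessel sequence such that $\sum_n\|x_n-\tilde y_n\|^2<\frac{1}{4D}$, and let $U$ be a bounded operator on $\ell^2(A)$ with $\|U\|<1$ and $\|U-I\|<\sqrt{\frac{C}{4D}}$. Then $\mathbf{M}_{U,Y,X}$ is invertible.
   Context: Hilbert $A$-modules are left modules whose $A$-valued inner product is $A$-linear in the first argument. $\ell^2(A)$ is the Hilbert $A$-module of sequences $\{a_n\}$ in $A$ such that $\sum_n a_na_n^*$ converges in norm, with $\langle\{a_n\},\{b_n\}\rangle=\sum_n a_nb_n^*$. $I$ is the identity operator on $\ell^2(A)$. A sequence $\{x_n\}\subset E$ is a standard frame if there are constants $C,D>0$ such that for every $x\in E$ the series $\sum_n\langle x,x_n\rangle\langle x_n,x\rangle$ converges in norm and $C\langle x,x\rangle\le\sum_n\langle x,x_n\rangle\langle x_n,x\rangle\le D\langle x,x\rangle$. The optimal constants (maximal $C$, minimal $D$) are called the frame bounds. It is a standard Bessel sequence if the series converges in norm and the upper inequality holds for some $D>0$. For a standard Bessel sequence $X=\{x_n\}$, the analysis operator is $T_X:E\to\ell^2(A)$,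 $T_Xx=\{\langle x,x_n\rangle\}_n$; it is adjointable with adjoint (synthesis operator) $T_X^*(\{a_n\})=\sum_n a_nx_n$. For a standard frame $Y$, the frame operator $S_Y=T_Y^*T_Y$ is positive and invertible, and the canonical dual frame is $\tilde y_n=S_Y^{-1}y_n$. For standard Bessel sequences $X,Y$ of $E$ and an operator $U$ on $\ell^2(A)$, the generalized multiplier is $\mathbf{M}_{U,Y,X}=T_Y^*UT_X:E\to E$. Invertible means bijective with bounded inverse. *)

theory Defs
  imports "HOL-Analysis.Analysis"
begin

text \<open>Unital \<open>C\<^sup>*\<close>-algebras. The complex scalar multiplication is required to extend
  the real one inherited from \<open>real_normed_algebra_1\<close>; the inherited axiom
  \<open>norm 1 = 1\<close> only excludes the zero algebra.\<close>

class cstar_algebra = real_normed_algebra_1 + banach +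
  fixes scaleC :: "complex \<Rightarrow> 'a \<Rightarrow> 'a" (infixr \<open>*\<^sub>C\<close> 75)
    and star :: "'a \<Rightarrow> 'a"
  assumes scaleC_complex_of_real: "complex_of_real r *\<^sub>C x = r *\<^sub>R x"
    and scaleC_add_right: "c *\<^sub>C (x + y) = c *\<^sub>C x + c *\<^sub>C y"
    and scaleC_add_left: "(c + d) *\<^sub>C x = c *\<^sub>C x + d *\<^sub>C x"
    and scaleC_scaleC: "c *\<^sub>C d *\<^sub>C x = (c * d) *\<^sub>C x"
    and mult_scaleC_left: "(c *\<^sub>C x) * y = c *\<^sub>C (x * y)"
    and mult_scaleC_right: "x * (c *\<^sub>C y) = c *\<^sub>C (x * y)"
    and norm_scaleC: "norm (c *\<^sub>C x) = cmod c * norm x"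
    and star_add: "star (x + y) = star x + star y"
    and star_scaleC: "star (c *\<^sub>C x) = cnj c *\<^sub>C star x"
    and star_mult: "star (x * y) = star y * star x"
    and star_star: "star (star x) = x"
    and norm_star_mult: "norm (star x * x) = (norm x)\<^sup>2"

definition cstar_spectrum :: "'a::cstar_algebra \<Rightarrow> complex set" where
  "cstar_spectrum a =
     {c. \<not> (\<exists>b. (a - c *\<^sub>C 1) * b = 1 \<and> b * (a - c *\<^sub>C 1) = 1)}"

definition cstar_positive :: "'a::cstar_algebra \<Rightarrow> bool" where
  "cstar_positive a \<longleftrightarrow>
     star a = a \<and> cstar_spectrum a \<subseteq> {c. Im c = 0 \<and> 0 \<le> Re c}"

definition cstar_le :: "'a::cstar_algebra \<Rightarrow> 'a \<Rightarrow> bool" (infix \<open>\<preceq>\<close> 50) where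
  "a \<preceq> b \<longleftrightarrow> cstar_positive (b - a)"

text \<open>A Hilbert module over \<open>'a\<close> with underlying space \<open>'e\<close>; completeness comes from
  the class \<open>banach\<close>. As \<open>'a\<close> is unital, the complex vector space structure of \<open>'e\<close> is
  \<open>\<lambda>c x. act (c *\<^sub>C 1) x\<close>, of which the real one is required to be a restriction.\<close>

locale hilbert_module =
  fixes act :: "'a::cstar_algebra \<Rightarrow> 'e::banach \<Rightarrow> 'e"
    and ip :: "'e \<Rightarrow> 'e \<Rightarrow> 'a"
  assumes act_add_right: "act a (x + y) = act a x + act a y"
    and act_add_left: "act (a + b) x = act a x + act b x"
    and act_act: "act a (act b x) = act (a * b) x"
    and act_one: "act 1 x = x"
    and act_scaleR_one: "act (r *\<^sub>R 1) x = r *\<^sub>R x"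
    and ip_add_left: "ip (x + y) z = ip x z + ip y z"
    and ip_act_left: "ip (act a x) y = a * ip x y"
    and ip_star: "star (ip x y) = ip y x"
    and ip_positive: "cstar_positive (ip x x)"
    and ip_definite: "ip x x = 0 \<Longrightarrow> x = 0"
    and norm_eq_sqrt_ip: "norm x = sqrt (norm (ip x x))"

definition alg_span :: "('a::cstar_algebra \<Rightarrow> 'e::banach \<Rightarrow> 'e) \<Rightarrow> 'e set \<Rightarrow> 'e set" where
  "alg_span act G = {\<Sum>g\<in>F. act (a g) g | F a. finite F \<and> F \<subseteq> G}"

definition finitely_generated :: "('a::cstar_algebra \<Rightarrow> 'e::banach \<Rightarrow> 'e) \<Rightarrow> bool" where
  "finitely_generated act \<longleftrightarrow> (\<exists>G. finite G \<and> alg_span act G = UNIV)"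

definition countably_generated :: "('a::cstar_algebra \<Rightarrow> 'e::banach \<Rightarrow> 'e) \<Rightarrow> bool" where
  "countably_generated act \<longleftrightarrow> (\<exists>G. countable G \<and> closure (alg_span act G) = UNIV)"

definition l2 :: "(nat \<Rightarrow> 'a::cstar_algebra) set" where
  "l2 = {a. summable (\<lambda>n. a n * star (a n))}"

definition l2_ip :: "(nat \<Rightarrow> 'a::cstar_algebra) \<Rightarrow> (nat \<Rightarrow> 'a) \<Rightarrow> 'a" where
  "l2_ip a b = (\<Sum>n. a n * star (b n))"

definition l2_norm :: "(nat \<Rightarrow> 'a::cstar_algebra) \<Rightarrow> real" where
  "l2_norm a = sqrt (norm (l2_ip a a))"

text \<open>An operator is a function on all sequences of which only the values on \<open>l2\<close> matter.
  It is complex linear on \<open>l2\<close>; linearity over \<open>'a\<close> is not required.\<close>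

definition l2_bounded_operator ::
    "((nat \<Rightarrow> 'a::cstar_algebra) \<Rightarrow> (nat \<Rightarrow> 'a)) \<Rightarrow> bool" where
  "l2_bounded_operator U \<longleftrightarrow>
     (\<forall>a\<in>l2. U a \<in> l2) \<and>
     (\<forall>a\<in>l2. \<forall>b\<in>l2. U (\<lambda>n. a n + b n) = (\<lambda>n. U a n + U b n)) \<and>
     (\<forall>c. \<forall>a\<in>l2. U (\<lambda>n. c *\<^sub>C a n) = (\<lambda>n. c *\<^sub>C U a n)) \<and>
     (\<exists>K. \<forall>a\<in>l2. l2_norm (U a) \<le> K * l2_norm a)"

definition l2_onorm :: "((nat \<Rightarrow> 'a::cstar_algebra) \<Rightarrow> (nat \<Rightarrow> 'a)) \<Rightarrow> real" where
  "l2_onorm U = (SUP a\<in>{a\<in>l2. l2_norm a \<le> 1}. l2_norm (U a))"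

definition upper_frame_constant ::
    "('e::banach \<Rightarrow> 'e \<Rightarrow> 'a::cstar_algebra) \<Rightarrow> (nat \<Rightarrow> 'e) \<Rightarrow> real \<Rightarrow> bool" where
  "upper_frame_constant ip X D \<longleftrightarrow>
     D > 0 \<and> (\<forall>x. (\<Sum>n. ip x (X n) * ip (X n) x) \<preceq> D *\<^sub>R ip x x)"

definition lower_frame_constant ::
    "('e::banach \<Rightarrow> 'e \<Rightarrow> 'a::cstar_algebra) \<Rightarrow> (nat \<Rightarrow> 'e) \<Rightarrow> real \<Rightarrow> bool" where
  "lower_frame_constant ip X C \<longleftrightarrow>
     C > 0 \<and> (\<forall>x. C *\<^sub>R ip x x \<preceq> (\<Sum>n. ip x (X n) * ip (X n) x))"

definition standard_bessel ::
    "('e::banach \<Rightarrow> 'e \<Rightarrow> 'a::cstar_algebra) \<Rightarrow> (nat \<Rightarrow> 'e) \<Rightarrow> bool" where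
  "standard_bessel ip X \<longleftrightarrow>
     (\<forall>x. summable (\<lambda>n. ip x (X n) * ip (X n) x)) \<and>
     (\<exists>D. upper_frame_constant ip X D)"

definition standard_frame ::
    "('e::banach \<Rightarrow> 'e \<Rightarrow> 'a::cstar_algebra) \<Rightarrow> (nat \<Rightarrow> 'e) \<Rightarrow> bool" where
  "standard_frame ip X \<longleftrightarrow>
     (\<forall>x. summable (\<lambda>n. ip x (X n) * ip (X n) x)) \<and>
     (\<exists>C. lower_frame_constant ip X C) \<and> (\<exists>D. upper_frame_constant ip X D)"

text \<open>Frame bounds are the optimal constants. On the zero module every positive number is
  a frame constant, so there are none.\<close>

definition frame_bounds ::
    "('e::banach \<Rightarrow> 'e \<Rightarrow> 'a::cstar_algebra) \<Rightarrow> (nat \<Rightarrow> 'e) \<Rightarrow> real \<Rightarrow> real \<Rightarrow> bool" where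
  "frame_bounds ip X C D \<longleftrightarrow>
     lower_frame_constant ip X C \<and> (\<forall>C'. lower_frame_constant ip X C' \<longrightarrow> C' \<le> C) \<and>
     upper_frame_constant ip X D \<and> (\<forall>D'. upper_frame_constant ip X D' \<longrightarrow> D \<le> D')"

definition analysis_op ::
    "('e::banach \<Rightarrow> 'e \<Rightarrow> 'a::cstar_algebra) \<Rightarrow> (nat \<Rightarrow> 'e) \<Rightarrow> 'e \<Rightarrow> (nat \<Rightarrow> 'a)" where
  "analysis_op ip X x = (\<lambda>n. ip x (X n))"

definition synthesis_op ::
    "('a::cstar_algebra \<Rightarrow> 'e::banach \<Rightarrow> 'e) \<Rightarrow> (nat \<Rightarrow> 'e) \<Rightarrow> (nat \<Rightarrow> 'a) \<Rightarrow> 'e" where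
  "synthesis_op act X a = (\<Sum>n. act (a n) (X n))"

definition frame_op ::
    "('a::cstar_algebra \<Rightarrow> 'e::banach \<Rightarrow> 'e) \<Rightarrow> ('e \<Rightarrow> 'e \<Rightarrow> 'a) \<Rightarrow> (nat \<Rightarrow> 'e) \<Rightarrow> 'e \<Rightarrow> 'e" where
  "frame_op act ip Y x = synthesis_op act Y (analysis_op ip Y x)"

definition canonical_dual ::
    "('a::cstar_algebra \<Rightarrow> 'e::banach \<Rightarrow> 'e) \<Rightarrow> ('e \<Rightarrow> 'e \<Rightarrow> 'a) \<Rightarrow> (nat \<Rightarrow> 'e) \<Rightarrow> nat \<Rightarrow> 'e" where
  "canonical_dual act ip Y n = inv (frame_op act ip Y) (Y n)"

definition multiplier ::
    "('a::cstar_algebra \<Rightarrow> 'e::banach \<Rightarrow> 'e) \<Rightarrow> ('e \<Rightarrow> 'e \<Rightarrow> 'a) \<Rightarrow>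
     ((nat \<Rightarrow> 'a) \<Rightarrow> (nat \<Rightarrow> 'a)) \<Rightarrow> (nat \<Rightarrow> 'e) \<Rightarrow> (nat \<Rightarrow> 'e) \<Rightarrow> 'e \<Rightarrow> 'e" where
  "multiplier act ip U Y X x = synthesis_op act Y (U (analysis_op ip X x))"

definition invertible_operator :: "('e::banach \<Rightarrow> 'e) \<Rightarrow> bool" where
  "invertible_operator M \<longleftrightarrow> bij M \<and> bounded_linear (inv M)"

end

theory Submission
  imports Defs
begin

text \<open>Let \<open>T\<close> be the analysis operator of the canonical dual. Since \<open>T\<^sub>Y\<^sup>* T = I\<close>, the difference
  \<open>M - I = T\<^sub>Y\<^sup>* U (T\<^sub>X - T) + T\<^sub>Y\<^sup>* (U - I) T\<close> has norm less than \<open>1 / 2 + 1 / 2\<close>, because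
  \<open>T\<^sub>Y\<^sup>*\<close> is bounded by \<open>sqrt D\<close>, \<open>T\<close> by \<open>1 / sqrt C\<close>, and \<open>T\<^sub>X - T\<close> by the square root of the sum
  of the \<open>norm (x\<^sub>n - S\<^sub>Y\<^sup>-\<^sup>1 y\<^sub>n)\<^sup>2\<close>; hence \<open>M\<close> is invertible by a Neumann argument.
  The bounds need the order on a \<open>C\<^sup>*\<close>-algebra: positive elements, defined by their spectrum, form
  a closed cone on which the norm is monotone and which contains every \<open>a\<^sup>* a\<close>. This rests on the fact
  that \<open>norm h\<close> or \<open>- norm h\<close> lies in the spectrum of a selfadjoint \<open>h\<close>.\<close>

subsection \<open>Invertible elements and spectra\<close>

text \<open>Neither functional calculus nor complex function theory is used. Two standard tools are
  replaced. The spectral radius formula gives way to averages of resolvents over roots of unity. The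
  splitting of a selfadjoint element into positive and negative parts, the usual route to the
  positivity of \<open>star a * a\<close>, gives way to lowering \<open>b\<close> in
  \<open>star a * a + b\<close> under a resolvent bound of order \<open>1 / b\<close>. The obstacle
  there is circularity: a lower bound for \<open>star c * c\<close> has to come from an upper bound
  for \<open>c * star c\<close>, never from positivity of \<open>star c * c\<close> itself. On the
  module side, \<open>U\<close> is only complex linear on \<open>l2\<close> and may have no adjoint,
  so \<open>M - I\<close> can be controlled only through norms. The triangle inequality is applied
  after synthesis, in the module, where the norm is already known to be one. The order on the
  algebra supplies the constants \<open>sqrt D\<close> and \<open>1 / sqrt C\<close> without
  loss.\<close>

definition unit_elt :: "'a::ring_1 \<Rightarrow> bool" where
  "unit_elt a \<longleftrightarrow> (\<exists>b. a * b = 1 \<and> b * a = 1)"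

lemma unit_eltI: "a * b = 1 \<Longrightarrow> b * a = 1 \<Longrightarrow> unit_elt a"
  unfolding unit_elt_def by blast

lemma unit_eltE:
  assumes "unit_elt a"
  obtains b where "a * b = 1" "b * a = 1"
  using assms unfolding unit_elt_def by blast

lemma unit_elt_mult:
  assumes "unit_elt a" "unit_elt b"
  shows "unit_elt (a * b)"
proof -
  obtain a' where a': "a * a' = 1" "a' * a = 1" using assms(1) by (rule unit_eltE)
  obtain b' where b': "b * b' = 1" "b' * b = 1" using assms(2) by (rule unit_eltE)
  have "a * b * (b' * a') = a * (b * b') * a'" by (simp only: mult.assoc)
  moreover have "b' * a' * (a * b) = b' * (a' * a) * b" by (simp only: mult.assoc)
  ultimately show ?thesis using a' b' by (intro unit_eltI[of _ "b' * a'"]) simp_all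
qed

lemma unit_elt_minus [simp]: "unit_elt (- a) \<longleftrightarrow> unit_elt a"
  unfolding unit_elt_def by (metis minus_mult_minus minus_minus)

text \<open>Jacobson's lemma: \<open>1 + y z x\<close> inverts \<open>1 - y x\<close> when \<open>z\<close> inverts \<open>1 - x y\<close>.\<close>

lemma unit_elt_one_minus_mult_commute:
  fixes x y :: "'a::ring_1"
  assumes "unit_elt (1 - x * y)"
  shows "unit_elt (1 - y * x)"
proof -
  obtain z where z: "(1 - x * y) * z = 1" "z * (1 - x * y) = 1"
    using assms by (rule unit_eltE)
  have 1: "x * y * z = z - 1" and 2: "z * x * y = z - 1"
    using z by (simp_all add: algebra_simps)
  have "(1 - y * x) * (1 + y * z * x) = 1 + y * (z - 1 - x * y * z) * x"
    by (simp add: algebra_simps)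
  moreover have "(1 + y * z * x) * (1 - y * x) = 1 + y * (z - 1 - z * x * y) * x"
    by (simp add: algebra_simps)
  ultimately show ?thesis using 1 2 by (intro unit_eltI[of _ "1 + y * z * x"]) simp_all
qed

lemma unit_elt_one_minus:
  fixes x :: "'a::{real_normed_algebra_1, banach}"
  assumes "norm x < 1"
  shows "unit_elt (1 - x)"
proof -
  have "summable (\<lambda>n. norm x ^ n)" using assms by (simp add: summable_geometric)
  then have s: "summable (\<lambda>n. x ^ n)"
    by (rule summable_norm_cancel[OF summable_comparison_test'[of _ 0]]) (simp add: norm_power_ineq)
  have "(\<Sum>n. x ^ Suc n) = (\<Sum>n. x ^ n) - 1"
    using suminf_split_head[OF s] by simp
  moreover have "(\<Sum>n. x ^ Suc n) = x * (\<Sum>n. x ^ n)"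
    using suminf_mult[OF s, of x] by simp
  moreover have "(\<Sum>n. x ^ Suc n) = (\<Sum>n. x ^ n) * x"
    using suminf_mult2[OF s, of x] by (simp add: power_commutes)
  ultimately show ?thesis
    by (intro unit_eltI[of _ "\<Sum>n. x ^ n"]) (simp_all add: algebra_simps)
qed

text \<open>The unit group contains the ball of radius \<open>1 / norm b\<close> around
  \<open>a\<close>. This size lets a resolvent bound move the spectral parameter in
  \<open>cstar_positive_star_mult\<close>.\<close>

lemma unit_elt_perturb:
  fixes a b x :: "'a::{real_normed_algebra_1, banach}"
  assumes "a * b = 1" "b * a = 1" "norm b * norm x < 1"
  shows "unit_elt (a - x)"
proof -
  have "norm (b * x) < 1"
    using norm_mult_ineq[of b x] assms(3) by linarith
  then have "unit_elt (a * (1 - b * x))"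
    using assms(1,2) by (intro unit_elt_mult unit_elt_one_minus) (auto intro: unit_eltI)
  moreover have "a * (1 - b * x) = a - a * b * x" by (simp add: algebra_simps)
  ultimately show ?thesis using assms(1) by simp
qed

lemma scaleC_one [simp]: "1 *\<^sub>C x = (x :: 'a::cstar_algebra)"
  using scaleC_complex_of_real[of 1 x] by simp

lemma scaleC_zero_left [simp]: "0 *\<^sub>C x = (0 :: 'a::cstar_algebra)"
  using scaleC_complex_of_real[of 0 x] by simp

lemma scaleC_zero_right [simp]: "c *\<^sub>C (0 :: 'a::cstar_algebra) = 0"
  using scaleC_add_right[of c "0 :: 'a" 0] by simp

lemma scaleC_minus_right: "c *\<^sub>C (- x) = - (c *\<^sub>C (x :: 'a::cstar_algebra))"
  using scaleC_add_right[of c x "- x"] by (simp add: eq_neg_iff_add_eq_0 add.commute)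

lemma scaleC_minus_left: "(- c) *\<^sub>C x = - (c *\<^sub>C (x :: 'a::cstar_algebra))"
  using scaleC_add_left[of c "- c" x] by (simp add: eq_neg_iff_add_eq_0 add.commute)

lemma scaleC_diff_right: "c *\<^sub>C (x - y) = c *\<^sub>C x - c *\<^sub>C (y :: 'a::cstar_algebra)"
  using scaleC_add_right[of c x "- y"] by (simp add: scaleC_minus_right)

lemma scaleC_diff_left: "(c - d) *\<^sub>C x = c *\<^sub>C x - d *\<^sub>C (x :: 'a::cstar_algebra)"
  using scaleC_add_left[of c "- d" x] by (simp add: scaleC_minus_left)

lemma star_scaleR: "star (r *\<^sub>R x) = r *\<^sub>R star (x :: 'a::cstar_algebra)"
  using star_scaleC[of "complex_of_real r" x] by (simp add: scaleC_complex_of_real)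

lemma star_zero [simp]: "star 0 = (0 :: 'a::cstar_algebra)"
  using star_add[of "0 :: 'a" 0] by simp

lemma star_minus: "star (- x) = - star (x :: 'a::cstar_algebra)"
  using star_add[of x "- x"] by (simp add: eq_neg_iff_add_eq_0 add.commute)

lemma star_diff: "star (x - y) = star x - star (y :: 'a::cstar_algebra)"
  using star_add[of x "- y"] by (simp add: star_minus)

lemma star_one [simp]: "star 1 = (1 :: 'a::cstar_algebra)"
  using star_mult[of "star 1 :: 'a" 1] by (simp add: star_star)

lemma star_sum: "star (\<Sum>i\<in>I. f i) = (\<Sum>i\<in>I. star (f i :: 'a::cstar_algebra))"
  by (induction I rule: infinite_finite_induct) (auto simp: star_add)

lemma scaleC_of_real: "complex_of_real r *\<^sub>C 1 = (of_real r :: 'a::cstar_algebra)"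
  unfolding scaleC_complex_of_real by (rule of_real_def[symmetric])

lemma star_of_real [simp]: "star (of_real r :: 'a::cstar_algebra) = of_real r"
  by (simp add: of_real_def star_scaleR)

lemma of_real_mult_eq_scaleR: "of_real r * (x :: 'a::cstar_algebra) = r *\<^sub>R x"
  by (simp add: scaleR_conv_of_real)

lemma mult_of_real_eq_scaleR: "(x :: 'a::cstar_algebra) * of_real r = r *\<^sub>R x"
  by (simp add: of_real_def)

lemma norm_star [simp]: "norm (star (x :: 'a::cstar_algebra)) = norm x"
proof -
  have *: "norm x \<le> norm (star x)" for x :: 'a
  proof (cases "x = 0")
    case False
    have "norm x * norm x \<le> norm (star x) * norm x"
      using norm_star_mult[of x] norm_mult_ineq[of "star x" x] by (simp add: power2_eq_square)
    then show ?thesis using False by simp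
  qed simp
  show ?thesis using *[of x] *[of "star x"] by (simp add: star_star)
qed

lemma norm_mult_star: "norm (x * star x) = (norm (x :: 'a::cstar_algebra))\<^sup>2"
  using norm_star_mult[of "star x"] by (simp add: star_star)

lemma bounded_linear_star: "bounded_linear (star :: 'a::cstar_algebra \<Rightarrow> 'a)"
  by (rule bounded_linear_intro[where K = 1]) (simp_all add: star_add star_scaleR)

lemma unit_elt_scaleC:
  fixes a :: "'a::cstar_algebra"
  assumes "c \<noteq> 0"
  shows "unit_elt (c *\<^sub>C a) \<longleftrightarrow> unit_elt a"
proof -
  have *: "unit_elt (c *\<^sub>C a)" if "unit_elt a" "c \<noteq> 0" for c and a :: 'a
  proof -
    obtain b where "a * b = 1" "b * a = 1" using \<open>unit_elt a\<close> by (rule unit_eltE)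
    then show ?thesis using \<open>c \<noteq> 0\<close>
      by (intro unit_eltI[of _ "(1 / c) *\<^sub>C b"])
        (simp_all add: mult_scaleC_left mult_scaleC_right scaleC_scaleC)
  qed
  show ?thesis
    using *[of "c *\<^sub>C a" "1 / c"] *[of a c] assms by (auto simp: scaleC_scaleC)
qed

lemma unit_elt_scaleR:
  fixes a :: "'a::cstar_algebra"
  assumes "r \<noteq> 0"
  shows "unit_elt (r *\<^sub>R a) \<longleftrightarrow> unit_elt a"
  using unit_elt_scaleC[of "complex_of_real r" a] assms by (simp add: scaleC_complex_of_real)

section \<open>Spectra of selfadjoint elements: reality and attainment of the norm\<close>

lemma unit_elt_minus_scaleC:
  fixes a :: "'a::cstar_algebra"
  assumes "norm a < cmod c"
  shows "unit_elt (a - c *\<^sub>C 1)"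
proof -
  have c: "c \<noteq> 0" using assms by auto
  have "norm ((1 / c) *\<^sub>C a) < 1" using assms c by (simp add: norm_scaleC norm_divide)
  then have "unit_elt (c *\<^sub>C (1 - (1 / c) *\<^sub>C a))"
    using c by (simp add: unit_elt_scaleC unit_elt_one_minus)
  also have "c *\<^sub>C (1 - (1 / c) *\<^sub>C a) = - (a - c *\<^sub>C 1)"
    using c by (simp add: scaleC_diff_right scaleC_scaleC)
  finally show ?thesis by (simp only: unit_elt_minus)
qed

text \<open>Arens' shift: adding an imaginary multiple \<open>i t\<close> of 1 to \<open>h\<close>
  raises the squared norm by at most \<open>t ^ 2\<close>, whereas the squared modulus of the
  shifted \<open>c\<close> also gains the cross term \<open>2 * t * Im c\<close>. A suitable
  \<open>t\<close> moves the point out of the disc containing the spectrum.\<close>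

lemma unit_elt_selfadjoint_nonreal:
  fixes h :: "'a::cstar_algebra"
  assumes "star h = h" "Im c \<noteq> 0"
  shows "unit_elt (h - c *\<^sub>C 1)"
proof -
  \<comment> \<open>This makes the cross term equal to \<open>(norm h) ^ 2\<close>. The surplus is
    then \<open>(Re c) ^ 2 + (Im c) ^ 2\<close>, which is strictly positive.\<close>
  define t where "t = (norm h)\<^sup>2 / (2 * Im c)"
  define g where "g = h + (\<i> * complex_of_real t) *\<^sub>C 1"
  have "star g * g = h * h + of_real (t\<^sup>2)"
    unfolding g_def
    by (simp add: star_add star_scaleC assms(1) algebra_simps mult_scaleC_left mult_scaleC_right
      scaleC_scaleC scaleC_minus_left scaleC_diff_right power2_eq_square flip: scaleC_of_real)
  then have "(norm g)\<^sup>2 \<le> norm (h * h) + t\<^sup>2"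
    using norm_triangle_ineq[of "h * h" "of_real (t\<^sup>2)"] norm_star_mult[of g]
    by (simp del: of_real_power)
  also have "norm (h * h) = (norm h)\<^sup>2"
    using norm_star_mult[of h] assms(1) by simp
  also have "(norm h)\<^sup>2 + t\<^sup>2 < (Re c)\<^sup>2 + (Im c + t)\<^sup>2"
  proof -
    have "(Im c + t)\<^sup>2 = (Im c)\<^sup>2 + (norm h)\<^sup>2 + t\<^sup>2"
      using assms(2) by (simp add: t_def power2_sum)
    then show ?thesis using assms(2) by (simp add: add_nonneg_pos)
  qed
  also have "\<dots> = (cmod (c + \<i> * complex_of_real t))\<^sup>2"
    by (simp add: cmod_power2)
  finally have "norm g < cmod (c + \<i> * complex_of_real t)"
    by (rule power2_less_imp_less) simp
  then have "unit_elt (g - (c + \<i> * complex_of_real t) *\<^sub>C 1)"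
    by (rule unit_elt_minus_scaleC)
  then show ?thesis by (simp add: g_def scaleC_add_left)
qed

text \<open>The C*-identity doubles exponents, hence the exponents \<open>2 ^ k\<close>. Such powers
  of a selfadjoint element of norm 1 do not shrink, which is what
  \<open>selfadjoint_norm_in_spectrum\<close> contradicts.\<close>

lemma norm_selfadjoint_power:
  fixes h :: "'a::cstar_algebra"
  assumes "star h = h"
  shows "norm (h ^ 2 ^ k) = norm h ^ 2 ^ k"
proof -
  have s: "star (h ^ n) = h ^ n" for n
    by (induction n) (simp_all add: star_mult assms power_commutes)
  show ?thesis
  proof (induction k)
    case (Suc k)
    have "h ^ 2 ^ Suc k = star (h ^ 2 ^ k) * h ^ 2 ^ k"
      by (simp add: s mult_2 power_add)
    then show ?case using Suc norm_star_mult[of "h ^ 2 ^ k"]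
      by (simp add: power_mult mult.commute[of 2] flip: power2_eq_square)
  qed simp
qed

text \<open>The resolvent identity gives continuity; compactness of the disc makes the bound uniform.\<close>

lemma resolvent_Lipschitz:
  fixes h :: "'a::cstar_algebra"
  assumes "\<And>w. cmod w \<le> 1 \<Longrightarrow> unit_elt (1 - w *\<^sub>C h)"
  obtains F K where "\<And>w. cmod w \<le> 1 \<Longrightarrow> F w * (1 - w *\<^sub>C h) = 1"
    and "\<And>w. cmod w \<le> 1 \<Longrightarrow> norm (F w) \<le> K"
    and "\<And>w z. cmod w \<le> 1 \<Longrightarrow> cmod z \<le> 1 \<Longrightarrow> norm (F w - F z) \<le> K * K * norm h * cmod (w - z)"
proof -
  obtain F where F: "\<And>w. cmod w \<le> 1 \<Longrightarrow> (1 - w *\<^sub>C h) * F w = 1 \<and> F w * (1 - w *\<^sub>C h) = 1"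
    using assms unfolding unit_elt_def by metis
  have res: "F w - F z = (w - z) *\<^sub>C (F w * h * F z)" if "cmod w \<le> 1" "cmod z \<le> 1" for w z
  proof -
    have "F w - F z = F w * ((1 - z *\<^sub>C h) * F z) - (F w * (1 - w *\<^sub>C h)) * F z"
      using F that by simp
    also have "\<dots> = F w * ((1 - z *\<^sub>C h) - (1 - w *\<^sub>C h)) * F z"
      by (simp only: mult.assoc[symmetric] left_diff_distrib right_diff_distrib)
    also have "(1 - z *\<^sub>C h) - (1 - w *\<^sub>C h) = (w - z) *\<^sub>C h"
      by (simp add: scaleC_diff_left)
    finally show ?thesis by (simp add: mult_scaleC_left mult_scaleC_right)
  qed
  have res_le: "norm (F w - F z) \<le> cmod (w - z) * (norm (F w) * norm h * norm (F z))"
    if "cmod w \<le> 1" "cmod z \<le> 1" for w z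
  proof -
    have "norm (F w * h * F z) \<le> norm (F w * h) * norm (F z)" by (rule norm_mult_ineq)
    also have "\<dots> \<le> norm (F w) * norm h * norm (F z)"
      by (intro mult_right_mono norm_mult_ineq) simp
    finally show ?thesis unfolding res[OF that] norm_scaleC by (intro mult_left_mono) simp_all
  qed
  have "continuous_on (cball 0 1) F"
    unfolding continuous_on_def
  proof
    fix z :: complex assume "z \<in> cball 0 1"
    then have z: "cmod z \<le> 1" by simp
    \<comment> \<open>The resolvent estimate for \<open>F w - F z\<close> contains
      \<open>norm (F w)\<close>, not yet known to be bounded near \<open>z\<close>. Once
      \<open>cmod (w - z) * L\<close> is below 1/2, that factor is absorbed and
      \<open>norm (F w)\<close> is at most twice \<open>norm (F z)\<close>.\<close>
    define L where "L = norm h * norm (F z)"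
    have L: "L \<ge> 0" by (simp add: L_def)
    have "((\<lambda>w. cmod (w - z) * L) \<longlongrightarrow> cmod (z - z) * L) (at z within cball 0 1)"
      by (intro tendsto_intros)
    then have "\<forall>\<^sub>F w in at z within cball 0 1. cmod (w - z) * L < 1 / 2"
      by (rule order_tendstoD) simp
    moreover have "\<forall>\<^sub>F w in at z within cball 0 1. w \<in> cball (0::complex) 1"
      by (auto simp: eventually_at_topological)
    ultimately have ev: "\<forall>\<^sub>F w in at z within cball 0 1. norm (F w - F z) \<le> cmod (w - z) * (2 * norm (F z) * L)"
    proof eventually_elim
      case (elim w)
      then have le: "norm (F w - F z) \<le> cmod (w - z) * L * norm (F w)"
        using res_le[of w z] z by (simp add: L_def algebra_simps)
      have "norm (F w) \<le> norm (F z) + norm (F w - F z)"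
        using norm_triangle_ineq[of "F z" "F w - F z"] by simp
      also have "\<dots> \<le> norm (F z) + 1 / 2 * norm (F w)"
        using le elim by (smt (verit) mult_right_mono norm_ge_zero)
      finally have "norm (F w) \<le> 2 * norm (F z)" by simp
      then have "cmod (w - z) * L * norm (F w) \<le> cmod (w - z) * L * (2 * norm (F z))"
        using L by (intro mult_left_mono) simp_all
      then show ?case using le by (simp add: algebra_simps)
    qed
    have "((\<lambda>w. cmod (w - z) * (2 * norm (F z) * L)) \<longlongrightarrow> cmod (z - z) * (2 * norm (F z) * L))
        (at z within cball 0 1)"
      by (intro tendsto_intros)
    then have "((\<lambda>w. F w - F z) \<longlongrightarrow> 0) (at z within cball 0 1)"
      using ev by (intro Lim_null_comparison[of "\<lambda>w. F w - F z"]) simp_all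
    then show "(F \<longlongrightarrow> F z) (at z within cball 0 1)" by (simp add: LIM_zero_iff)
  qed
  then have "bounded (F ` cball 0 1)"
    by (intro compact_imp_bounded compact_continuous_image) simp_all
  then obtain K where K: "\<And>w. cmod w \<le> 1 \<Longrightarrow> norm (F w) \<le> K"
    unfolding bounded_iff by (metis image_eqI mem_cball_0)
  have K0: "0 \<le> K" using K[of 0] norm_ge_zero[of "F 0"] by (simp del: norm_ge_zero)
  have "norm (F w - F z) \<le> K * K * norm h * cmod (w - z)"
    if wz: "cmod w \<le> 1" "cmod z \<le> 1" for w z
  proof -
    have "norm (F w) * norm h * norm (F z) \<le> K * norm h * K"
      using K[OF wz(1)] K[OF wz(2)] K0 by (intro mult_mono) simp_all
    then have "cmod (w - z) * (norm (F w) * norm h * norm (F z)) \<le> cmod (w - z) * (K * norm h * K)"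
      by (intro mult_left_mono) simp_all
    then show ?thesis using res_le[OF wz] by (simp add: algebra_simps)
  qed
  then show ?thesis using that[of F K] F K by blast
qed

text \<open>Passing from \<open>h\<close> to \<open>h\<^sup>2\<close> averages the resolvent over \<open>w\<close> and its product with a root of \<open>-1\<close>,
  which preserves all bounds.\<close>

lemma resolvent_average:
  fixes h :: "'a::cstar_algebra"
  assumes "\<And>w. cmod w \<le> 1 \<Longrightarrow> unit_elt (1 - w *\<^sub>C h)"
  obtains K L where "\<And>k. \<exists>G. (\<forall>w. cmod w \<le> 1 \<longrightarrow> G w * (1 - w ^ 2 ^ k *\<^sub>C h ^ 2 ^ k) = 1 \<and>
    norm (G w) \<le> K \<and> (\<forall>r\<in>{0..1}. norm (G w - G (r *\<^sub>R w)) \<le> L * (1 - r)))"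
proof -
  obtain F K where F: "\<And>w. cmod w \<le> 1 \<Longrightarrow> F w * (1 - w *\<^sub>C h) = 1"
    "\<And>w. cmod w \<le> 1 \<Longrightarrow> norm (F w) \<le> K"
    "\<And>w z. cmod w \<le> 1 \<Longrightarrow> cmod z \<le> 1 \<Longrightarrow> norm (F w - F z) \<le> K * K * norm h * cmod (w - z)"
    using resolvent_Lipschitz[OF assms] by metis
  define L where "L = K * K * norm h"
  have "\<exists>G. (\<forall>w. cmod w \<le> 1 \<longrightarrow> G w * (1 - w ^ 2 ^ k *\<^sub>C h ^ 2 ^ k) = 1 \<and>
    norm (G w) \<le> K \<and> (\<forall>r\<in>{0..1}. norm (G w - G (r *\<^sub>R w)) \<le> L * (1 - r)))" for k
  proof (induction k)
    case 0
    have "norm (F w - F (r *\<^sub>R w)) \<le> L * (1 - r)" if w: "cmod w \<le> 1" and r: "r \<in> {0..1}" for w r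
    proof -
      have "cmod (r *\<^sub>R w) \<le> 1" using w r by (simp add: mult_le_one)
      moreover have "cmod (w - r *\<^sub>R w) \<le> 1 - r"
      proof -
        have "w - r *\<^sub>R w = (1 - r) *\<^sub>R w" by (simp add: algebra_simps)
        then have "cmod (w - r *\<^sub>R w) = (1 - r) * cmod w" using r by simp
        then show ?thesis using w r by (simp add: mult_left_le)
      qed
      moreover have "L \<ge> 0" by (simp add: L_def)
      ultimately show ?thesis
        using F(3)[OF w, of "r *\<^sub>R w"] unfolding L_def by (meson mult_left_mono order_trans)
    qed
    then show ?case using F by (intro exI[of _ F]) simp
  next
    case (Suc k)
    then obtain G where G: "\<And>w. cmod w \<le> 1 \<Longrightarrow> G w * (1 - w ^ 2 ^ k *\<^sub>C h ^ 2 ^ k) = 1"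
      "\<And>w. cmod w \<le> 1 \<Longrightarrow> norm (G w) \<le> K"
      "\<And>w r. cmod w \<le> 1 \<Longrightarrow> r \<in> {0..1} \<Longrightarrow> norm (G w - G (r *\<^sub>R w)) \<le> L * (1 - r)"
      by metis
    \<comment> \<open>A root of -1 of order \<open>2 ^ k\<close>: replacing \<open>w\<close> by
      \<open>z * w\<close> flips the sign of \<open>b\<close>, so \<open>G w\<close> and
      \<open>G (z * w)\<close> left-invert \<open>1 - b\<close> and \<open>1 + b\<close>, and half
      their sum left-inverts \<open>1 - b * b\<close>.\<close>
    define z where "z = cis (pi / 2 ^ k)"
    have z: "z ^ 2 ^ k = -1" unfolding z_def by (simp only: Complex.DeMoivre) simp
    have zn: "cmod (z * w) = cmod w" for w by (simp add: z_def norm_mult)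
    define H where "H w = (1 / 2) *\<^sub>R (G w + G (z * w))" for w
    have "H w * (1 - w ^ 2 ^ Suc k *\<^sub>C h ^ 2 ^ Suc k) = 1" if w: "cmod w \<le> 1" for w
    proof -
      define b where "b = w ^ 2 ^ k *\<^sub>C h ^ 2 ^ k"
      have g1: "G w * (1 - b) = 1" using G(1)[OF w] by (simp add: b_def)
      have g2: "G (z * w) * (1 + b) = 1"
        using G(1)[of "z * w"] w z by (simp add: zn b_def power_mult_distrib scaleC_minus_left)
      have "w ^ 2 ^ Suc k *\<^sub>C h ^ 2 ^ Suc k = b * b"
        by (simp add: b_def mult_scaleC_left mult_scaleC_right scaleC_scaleC mult_2 power_add)
      then have "H w * (1 - w ^ 2 ^ Suc k *\<^sub>C h ^ 2 ^ Suc k)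
        = (1 / 2) *\<^sub>R (G w * (1 - b) * (1 + b) + G (z * w) * (1 + b) * (1 - b))"
        by (simp add: H_def algebra_simps)
      also have "\<dots> = (1 / 2) *\<^sub>R (1 + 1)" by (simp add: g1 g2)
      also have "\<dots> = 1" by (simp flip: scaleR_2)
      finally show ?thesis .
    qed
    moreover have "norm (H w) \<le> K" if w: "cmod w \<le> 1" for w
      using G(2)[of w] G(2)[of "z * w"] w norm_triangle_ineq[of "G w" "G (z * w)"]
      by (simp add: H_def zn)
    moreover have "norm (H w - H (r *\<^sub>R w)) \<le> L * (1 - r)" if w: "cmod w \<le> 1" and r: "r \<in> {0..1}" for w r
    proof -
      \<comment> \<open>The comparison runs along rays because scaling by \<open>r\<close> commutes
        with the rotation by \<open>z\<close>; each summand then contributes half of the old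
        bound.\<close>
      have "H w - H (r *\<^sub>R w) = (1 / 2) *\<^sub>R ((G w - G (r *\<^sub>R w)) + (G (z * w) - G (r *\<^sub>R (z * w))))"
        by (simp add: H_def algebra_simps)
      then show ?thesis
        using G(3)[OF w r] G(3)[of "z * w" r] w r
          norm_triangle_ineq[of "G w - G (r *\<^sub>R w)" "G (z * w) - G (r *\<^sub>R (z * w))"]
        by (simp add: zn)
    qed
    ultimately show ?case by (intro exI[of _ H]) simp
  qed
  then show ?thesis using that[of K L] by blast
qed

text \<open>After normalising to \<open>g\<close>, the resolvent exists on the whole closed disc.
  The averaged left inverse \<open>G\<close> of \<open>1 - w ^ 2 ^ N g ^ 2 ^ N\<close> is close to 1
  at a radius \<open>r < 1\<close> when \<open>N\<close> is large, and its value at 1 stays near its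
  value at \<open>r\<close> uniformly in \<open>N\<close>. So \<open>1 - x\<close>, with
  \<open>x\<close> a power of \<open>g\<close>, has a left inverse close to 1, which would make
  \<open>x\<close> small although its norm is 1.\<close>

lemma selfadjoint_norm_in_spectrum:
  fixes h :: "'a::cstar_algebra"
  assumes h: "star h = h" and u: "unit_elt (h - of_real (norm h))" "unit_elt (h + of_real (norm h))"
  shows False
proof -
  have nz: "h \<noteq> 0"
    using u(1) by (auto simp: unit_elt_def)
  define g where "g = (1 / norm h) *\<^sub>R h"
  have g: "star g = g" "norm g = 1" using h nz by (simp_all add: g_def star_scaleR)
  have eq: "g - 1 = (1 / norm h) *\<^sub>R (h - of_real (norm h))" "g + 1 = (1 / norm h) *\<^sub>R (h + of_real (norm h))"
    using nz by (simp_all add: g_def scaleR_diff_right scaleR_add_right of_real_def)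
  have ug: "unit_elt (g - 1)" "unit_elt (g + 1)"
    unfolding eq using u nz by (simp_all add: unit_elt_scaleR)
  have "unit_elt (1 - w *\<^sub>C g)" if w: "cmod w \<le> 1" for w
  proof (cases "cmod w < 1")
    case True
    then show ?thesis by (intro unit_elt_one_minus) (simp add: norm_scaleC g)
  next
    case False
    then have w1: "cmod w = 1" and w0: "w \<noteq> 0" using w by auto
    have eq: "1 - w *\<^sub>C g = - (w *\<^sub>C (g - (1 / w) *\<^sub>C 1))"
      using w0 by (simp add: scaleC_diff_right scaleC_scaleC)
    have "unit_elt (g - (1 / w) *\<^sub>C 1)"
    \<comment> \<open>On the unit circle \<open>1 / w\<close> is real only at 1 and -1, the two
      points covered by the assumptions.\<close>
    proof (cases "Im (1 / w) = 0")
      case True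
      then have "1 / w = complex_of_real (Re (1 / w))" by (simp add: complex_eq_iff)
      moreover have "cmod (1 / w) = 1" using w1 by (simp add: norm_divide)
      ultimately have "\<bar>Re (1 / w)\<bar> = 1" by (metis norm_of_real)
      then have "1 / w = 1 \<or> 1 / w = -1"
        using \<open>1 / w = complex_of_real (Re (1 / w))\<close> by (auto simp: abs_if split: if_splits)
      then show ?thesis using ug by (elim disjE) (simp_all add: scaleC_minus_left)
    qed (use g in \<open>simp add: unit_elt_selfadjoint_nonreal\<close>)
    then show ?thesis unfolding eq using w0 by (simp add: unit_elt_scaleC)
  qed
  then obtain K L where KL: "\<And>k. \<exists>G. (\<forall>w. cmod w \<le> 1 \<longrightarrow> G w * (1 - w ^ 2 ^ k *\<^sub>C g ^ 2 ^ k) = 1 \<and>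
    norm (G w) \<le> K \<and> (\<forall>r\<in>{0..1}. norm (G w - G (r *\<^sub>R w)) \<le> L * (1 - r)))"
    using resolvent_average[of g] by metis
  have K: "0 \<le> K" using KL[of 0] norm_ge_zero order_trans by (metis norm_zero zero_le_one)
  \<comment> \<open>Two errors are budgeted at 1/8 each: the radial step \<open>L * (1 - r)\<close>
    and the remainder \<open>K * r ^ 2 ^ N\<close>. They give \<open>norm (G 1 - 1) < 1 / 4\<close>
    and hence \<open>norm x < 1 / 2\<close>. Since \<open>L\<close> and \<open>K\<close> do not
    depend on the exponent, \<open>r\<close> can be fixed before \<open>N\<close>.\<close>
  define e where "e = min (1/2) (1 / (8 * (\<bar>L\<bar> + 1)))"
  have e: "0 < e" "e \<le> 1 / 2" by (simp_all add: e_def)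
  have "L * e \<le> (\<bar>L\<bar> + 1) * e" using e by (intro mult_right_mono) simp_all
  also have "\<dots> \<le> (\<bar>L\<bar> + 1) * (1 / (8 * (\<bar>L\<bar> + 1)))" by (intro mult_left_mono) (simp_all add: e_def)
  also have "\<dots> = 1 / 8" by (simp add: field_simps)
  finally have Le: "L * e \<le> 1 / 8" .
  define r where "r = 1 - e"
  have r: "0 < r" "r < 1" using e by (simp_all add: r_def)
  have "(\<lambda>n. K * r ^ n) \<longlonglongrightarrow> K * 0" using r by (intro tendsto_intros LIMSEQ_power_zero) simp
  then have "\<forall>\<^sub>F n in sequentially. K * r ^ n < 1 / 8" by (rule order_tendstoD) simp
  then obtain N where N: "\<And>n. n \<ge> N \<Longrightarrow> K * r ^ n < 1 / 8"
    by (auto simp: eventually_sequentially)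
  define x where "x = g ^ 2 ^ N"
  have x: "norm x = 1" using norm_selfadjoint_power[OF g(1), of N] g by (simp add: x_def)
  obtain G where G: "\<And>w. cmod w \<le> 1 \<Longrightarrow> G w * (1 - w ^ 2 ^ N *\<^sub>C x) = 1"
    "\<And>w. cmod w \<le> 1 \<Longrightarrow> norm (G w) \<le> K"
    "\<And>w r. cmod w \<le> 1 \<Longrightarrow> r \<in> {0..1} \<Longrightarrow> norm (G w - G (r *\<^sub>R w)) \<le> L * (1 - r)"
    using KL[of N] unfolding x_def by metis
  define R where "R = G (complex_of_real r)"
  have "R * (1 - (r ^ 2 ^ N) *\<^sub>R x) = 1"
    using G(1)[of "complex_of_real r"] r by (simp add: R_def scaleC_complex_of_real flip: of_real_power)
  then have "R - 1 = (r ^ 2 ^ N) *\<^sub>R (R * x)" by (simp add: algebra_simps)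
  then have "norm (R - 1) = r ^ 2 ^ N * norm (R * x)" using r by simp
  also have "norm (R * x) \<le> K"
    using norm_mult_ineq[of R x] x G(2)[of "complex_of_real r"] r by (simp add: R_def)
  finally have "norm (R - 1) \<le> K * r ^ 2 ^ N" using r by (simp add: mult.commute)
  also have "\<dots> < 1 / 8" using N[of "2 ^ N"] by (simp add: less_imp_le)
  finally have R: "norm (R - 1) < 1 / 8" .
  have "norm (G 1 - R) \<le> 1 / 8"
    using G(3)[of 1 r] r Le by (simp add: R_def r_def scaleR_conv_of_real)
  then have d: "norm (G 1 - 1) < 1 / 4"
    using norm_triangle_ineq[of "G 1 - R" "R - 1"] R by simp
  have "G 1 * (1 - x) = 1" using G(1)[of 1] by simp
  then have "x = (G 1 - 1) - (G 1 - 1) * x" by (simp add: algebra_simps)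
  then have "norm x \<le> norm (G 1 - 1) + norm ((G 1 - 1) * x)"
    by (metis norm_triangle_ineq4)
  also have "\<dots> \<le> norm (G 1 - 1) + norm (G 1 - 1)"
    using norm_mult_ineq[of "G 1 - 1" x] x by simp
  finally show False using x d by simp
qed

subsection \<open>Positive elements\<close>

text \<open>The spectrum of a selfadjoint element is real, so only the negative reals
  \<open>- t\<close> have to be excluded. In this form positivity is open to algebraic arguments on
  invertibility.\<close>

lemma cstar_positive_iff_unit:
  fixes a :: "'a::cstar_algebra"
  shows "cstar_positive a \<longleftrightarrow> star a = a \<and> (\<forall>t>0. unit_elt (a + of_real t))"
proof -
  have spec: "c \<in> cstar_spectrum a \<longleftrightarrow> \<not> unit_elt (a - c *\<^sub>C 1)" for c
    by (simp add: cstar_spectrum_def unit_elt_def)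
  have shift: "a - complex_of_real (- t) *\<^sub>C 1 = a + of_real t" for t
    unfolding scaleC_of_real by simp
  show ?thesis
  proof (intro iffI conjI allI impI)
    assume p: "cstar_positive a"
    then show "star a = a" by (simp add: cstar_positive_def)
    fix t :: real assume "t > 0"
    then have "complex_of_real (- t) \<notin> cstar_spectrum a"
      using p by (auto simp: cstar_positive_def)
    then show "unit_elt (a + of_real t)" unfolding spec shift by blast
  next
    assume *: "star a = a \<and> (\<forall>t>0. unit_elt (a + of_real t))"
    have "Im c = 0 \<and> 0 \<le> Re c" if c: "c \<in> cstar_spectrum a" for c
    proof -
      have Im: "Im c = 0"
        using c * unit_elt_selfadjoint_nonreal[of a c] unfolding spec by blast
      then have "c = complex_of_real (- (- Re c))" by (simp add: complex_eq_iff)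
      then have "\<not> unit_elt (a + of_real (- Re c))" using c shift[of "- Re c"] by (simp add: spec)
      then show ?thesis using * Im by (metis neg_0_less_iff_less not_le)
    qed
    then show "cstar_positive a" using * by (auto simp: cstar_positive_def)
  qed
qed

lemma cstar_positive_star: "cstar_positive a \<Longrightarrow> star a = a"
  by (simp add: cstar_positive_def)

text \<open>The spectrum lies in the disc of radius \<open>t\<close> about \<open>t\<close>, which
  touches the negative axis only at 0. With the converse \<open>cstar_positive_norm_le\<close> this
  turns positivity into a condition that is visibly convex and closed.\<close>

lemma cstar_positiveI_norm:
  fixes a :: "'a::cstar_algebra"
  assumes "star a = a" "norm (of_real t - a) \<le> t"
  shows "cstar_positive a"
  unfolding cstar_positive_iff_unit
proof (intro conjI allI impI)
  fix s :: real assume s: "s > 0"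
  have "0 \<le> t" using assms(2) norm_ge_zero order_trans by blast
  then have "norm (a - of_real t) < cmod (complex_of_real (- (s + t)))"
    unfolding norm_of_real using s assms(2) norm_minus_commute[of a "of_real t"] by linarith
  then have "unit_elt ((a - of_real t) - complex_of_real (- (s + t)) *\<^sub>C 1)"
    by (rule unit_elt_minus_scaleC)
  also have "(a - of_real t) - complex_of_real (- (s + t)) *\<^sub>C 1 = a + of_real s"
    unfolding scaleC_of_real by simp
  finally show "unit_elt (a + of_real s)" .
qed fact

text \<open>For \<open>h = t - a\<close> with norm \<open>s > t\<close>, the value \<open>s\<close>
  in the spectrum of \<open>h\<close> would put \<open>t - s < 0\<close> in that of
  \<open>a\<close>, and \<open>- s\<close> would put \<open>t + s > norm a\<close> there. One of the
  two must occur.\<close>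

lemma cstar_positive_norm_le:
  fixes a :: "'a::cstar_algebra"
  assumes "cstar_positive a" "norm a \<le> t"
  shows "norm (of_real t - a) \<le> t"
proof (rule ccontr)
  assume "\<not> norm (of_real t - a) \<le> t"
  define h where "h = of_real t - a"
  define s where "s = norm h"
  have st: "s > t" using \<open>\<not> norm (of_real t - a) \<le> t\<close> by (simp add: s_def h_def)
  have t0: "0 \<le> t" using assms(2) norm_ge_zero order_trans by blast
  have "star h = h"
    using assms(1) by (simp add: h_def star_diff cstar_positive_star)
  moreover have "unit_elt (h - of_real s)"
  proof -
    have "unit_elt (a + of_real (s - t))"
      using assms(1) st by (simp add: cstar_positive_iff_unit del: of_real_diff)
    moreover have "h - of_real s = - (a + of_real (s - t))" by (simp add: h_def)
    ultimately show ?thesis by (simp only: unit_elt_minus)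
  qed
  moreover have "unit_elt (h + of_real s)"
  proof -
    have "norm a < cmod (complex_of_real (s + t))"
      unfolding norm_of_real using st t0 assms(2) by linarith
    then have "unit_elt (a - complex_of_real (s + t) *\<^sub>C 1)" by (rule unit_elt_minus_scaleC)
    then have "unit_elt (a - of_real (s + t))" by (simp only: scaleC_of_real)
    moreover have "h + of_real s = - (a - of_real (s + t))" by (simp add: h_def)
    ultimately show ?thesis by (simp only: unit_elt_minus)
  qed
  ultimately show False unfolding s_def by (rule selfadjoint_norm_in_spectrum)
qed

lemma cstar_positive_add:
  fixes a b :: "'a::cstar_algebra"
  assumes "cstar_positive a" "cstar_positive b"
  shows "cstar_positive (a + b)"
proof (rule cstar_positiveI_norm)
  show "star (a + b) = a + b" using assms by (simp add: star_add cstar_positive_star)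
  have "norm (of_real (norm a + norm b) - (a + b))
    \<le> norm (of_real (norm a) - a) + norm (of_real (norm b) - b)"
    unfolding of_real_add by (rule norm_diff_triangle_ineq)
  also have "\<dots> \<le> norm a + norm b"
    using assms by (intro add_mono cstar_positive_norm_le) simp_all
  finally show "norm (of_real (norm a + norm b) - (a + b)) \<le> norm a + norm b" .
qed

lemma cstar_positive_of_real:
  assumes "0 \<le> r"
  shows "cstar_positive (of_real r :: 'a::cstar_algebra)"
  by (rule cstar_positiveI_norm[of _ r]) (use assms in simp_all)

lemma cstar_positive_zero [simp]: "cstar_positive (0 :: 'a::cstar_algebra)"
  using cstar_positive_of_real[of 0] by simp

lemma cstar_positive_scaleR:
  fixes a :: "'a::cstar_algebra"
  assumes "cstar_positive a" "0 \<le> r"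
  shows "cstar_positive (r *\<^sub>R a)"
proof (rule cstar_positiveI_norm)
  show "star (r *\<^sub>R a) = r *\<^sub>R a" using assms by (simp add: star_scaleR cstar_positive_star)
  have "of_real (r * norm a) - r *\<^sub>R a = r *\<^sub>R (of_real (norm a) - a)"
    by (simp add: of_real_def scaleR_diff_right)
  then show "norm (of_real (r * norm a) - r *\<^sub>R a) \<le> r * norm a"
    using cstar_positive_norm_le[OF assms(1) order_refl] assms(2) by (simp add: mult_left_mono)
qed

lemma cstar_positive_sum:
  fixes f :: "'i \<Rightarrow> 'a::cstar_algebra"
  assumes "\<And>i. i \<in> I \<Longrightarrow> cstar_positive (f i)"
  shows "cstar_positive (\<Sum>i\<in>I. f i)"
  using assms by (induction I rule: infinite_finite_induct) (auto intro: cstar_positive_add)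

lemma cstar_positive_limit:
  fixes f :: "nat \<Rightarrow> 'a::cstar_algebra"
  assumes "f \<longlonglongrightarrow> a" "\<And>n. cstar_positive (f n)"
  shows "cstar_positive a"
proof (rule cstar_positiveI_norm)
  show "star a = a"
    using bounded_linear.tendsto[OF bounded_linear_star assms(1)] assms
    by (simp add: cstar_positive_star LIMSEQ_unique)
  have "norm (of_real (norm (f n)) - f n) \<le> norm (f n)" for n
    using assms(2) by (intro cstar_positive_norm_le) simp_all
  moreover have "(\<lambda>n. norm (of_real (norm (f n)) - f n)) \<longlonglongrightarrow> norm (of_real (norm a) - a)"
    by (intro tendsto_intros assms(1))
  moreover have "(\<lambda>n. norm (f n)) \<longlonglongrightarrow> norm a" by (intro tendsto_intros assms(1))
  ultimately show "norm (of_real (norm a) - a) \<le> norm a" by (meson LIMSEQ_le)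
qed

lemma cstar_positive_norm_minus:
  fixes a :: "'a::cstar_algebra"
  assumes "star a = a" "norm a \<le> t"
  shows "cstar_positive (of_real t - a)"
  by (rule cstar_positiveI_norm[of _ t]) (use assms in \<open>simp_all add: star_diff\<close>)

text \<open>If \<open>norm b < norm a\<close>, then \<open>a\<close> is below the scalar
  \<open>norm b\<close>, so \<open>norm a\<close> is outside its spectrum; positivity keeps
  \<open>- norm a\<close> outside as well.\<close>

lemma cstar_positive_norm_mono:
  fixes a b :: "'a::cstar_algebra"
  assumes "cstar_positive a" "cstar_positive (b - a)"
  shows "norm a \<le> norm b"
proof (rule ccontr)
  assume "\<not> norm a \<le> norm b"
  then have lt: "norm b < norm a" by simp
  have sa: "star a = a" using assms by (simp add: cstar_positive_star)
  have "star b = b"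
    using cstar_positive_star[OF assms(2)] sa by (simp add: star_diff)
  then have "cstar_positive (of_real (norm b) - b)"
    by (simp add: cstar_positive_norm_minus)
  then have "cstar_positive (of_real (norm b) - a)"
    using cstar_positive_add[OF assms(2)] by fastforce
  then have "unit_elt (of_real (norm b) - a + of_real (norm a - norm b))"
    using lt by (simp add: cstar_positive_iff_unit del: of_real_diff)
  moreover have "a - of_real (norm a) = - (of_real (norm b) - a + of_real (norm a - norm b))"
    by simp
  ultimately have "unit_elt (a - of_real (norm a))" by (simp only: unit_elt_minus)
  moreover have "unit_elt (a + of_real (norm a))"
    using assms(1) lt norm_ge_zero[of b] order_le_less_trans
    unfolding cstar_positive_iff_unit by blast
  ultimately show False using selfadjoint_norm_in_spectrum[OF sa] by blast
qed

text \<open>\<open>h * h + t\<close> factors into \<open>h - c\<close> and \<open>h + c\<close> with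
  \<open>c = i sqrt t\<close>, both invertible because \<open>c\<close> is not real.\<close>

lemma cstar_positive_selfadjoint_square:
  fixes h :: "'a::cstar_algebra"
  assumes "star h = h"
  shows "cstar_positive (h * h)"
  unfolding cstar_positive_iff_unit
proof (intro conjI allI impI)
  show "star (h * h) = h * h" by (simp add: star_mult assms)
  fix t :: real assume "t > 0"
  define c where "c = \<i> * complex_of_real (sqrt t)"
  have "Im c \<noteq> 0" using \<open>t > 0\<close> by (simp add: c_def)
  then have "unit_elt ((h - c *\<^sub>C 1) * (h - (- c) *\<^sub>C 1))"
    using assms by (intro unit_elt_mult unit_elt_selfadjoint_nonreal) simp_all
  also have "(h - c *\<^sub>C 1) * (h - (- c) *\<^sub>C 1) = h * h - (c * c) *\<^sub>C 1"
    by (simp add: algebra_simps scaleC_minus_left mult_scaleC_left mult_scaleC_right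
      scaleC_scaleC scaleC_diff_right scaleC_add_right)
  also have "c * c = complex_of_real (- t)"
    using \<open>t > 0\<close> by (simp add: c_def algebra_simps flip: of_real_mult)
  also have "h * h - complex_of_real (- t) *\<^sub>C 1 = h * h + of_real t"
    unfolding scaleC_of_real by simp
  finally show "unit_elt (h * h + of_real t)" .
qed

section \<open>Positivity of \<open>star a * a\<close>\<close>

lemma cstar_positive_commutator_sum:
  fixes c :: "'a::cstar_algebra"
  shows "cstar_positive (star c * c + c * star c)"
proof -
  \<comment> \<open>With \<open>c = u + i v\<close> for selfadjoint \<open>u\<close> and
    \<open>v\<close>, \<open>c + star c\<close> is \<open>2 u\<close> and \<open>d\<close> is
    \<open>- 2 v\<close>; the claim is that \<open>2 (u ^ 2 + v ^ 2)\<close> is positive.\<close>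
  define d where "d = \<i> *\<^sub>C (c - star c)"
  have "star (c + star c) = c + star c" by (simp add: star_add star_star add.commute)
  moreover have "star d = d"
    by (simp add: d_def star_scaleC star_diff star_star scaleC_minus_left scaleC_diff_right)
  ultimately have "cstar_positive ((1 / 2) *\<^sub>R ((c + star c) * (c + star c) + d * d))"
    by (intro cstar_positive_scaleR cstar_positive_add cstar_positive_selfadjoint_square) simp_all
  also have "d * d = - ((c - star c) * (c - star c))"
    by (simp add: d_def mult_scaleC_left mult_scaleC_right scaleC_scaleC scaleC_minus_left)
  also have "(c + star c) * (c + star c) + - ((c - star c) * (c - star c))
    = 2 *\<^sub>R (star c * c + c * star c)"
    by (simp add: algebra_simps scaleR_2)
  finally show ?thesis by simp
qed

text \<open>By Jacobson's lemma the spectra of \<open>star c * c\<close> and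
  \<open>c * star c\<close> agree away from 0, so an upper bound \<open>e\<close> passes from one to
  the other.\<close>

lemma cstar_positive_of_real_minus_commute:
  fixes c :: "'a::cstar_algebra"
  assumes "0 \<le> e" "cstar_positive (of_real e - star c * c)"
  shows "cstar_positive (of_real e - c * star c)"
  unfolding cstar_positive_iff_unit
proof (intro conjI allI impI)
  show "star (of_real e - c * star c) = of_real e - c * star c"
    by (simp add: star_diff star_mult star_star)
  fix t :: real assume t: "t > 0"
  define s where "s = e + t"
  have s: "s > 0" using assms(1) t by (simp add: s_def)
  have eq: "of_real e - x + of_real t = s *\<^sub>R (1 - (1 / s) *\<^sub>R x)" for x :: 'a
    using s by (simp add: s_def of_real_def algebra_simps)
  have "unit_elt (of_real e - star c * c + of_real t)"
    using assms(2) t by (simp add: cstar_positive_iff_unit)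
  then have "unit_elt (1 - star c * ((1 / s) *\<^sub>R c))"
    unfolding eq using s by (simp add: unit_elt_scaleR)
  then have "unit_elt (1 - (1 / s) *\<^sub>R c * star c)"
    by (rule unit_elt_one_minus_mult_commute)
  then show "unit_elt (of_real e - c * star c + of_real t)"
    unfolding eq using s by (simp add: unit_elt_scaleR)
qed

text \<open>If \<open>h = a\<^sup>* a\<close> and \<open>r = (h + b)\<^sup>-\<^sup>1\<close>, then \<open>c = a r\<close> satisfies
  \<open>c\<^sup>* c = r h r = r - b r\<^sup>2 = 1 / (4 b) - b (r - 1 / (2 b))\<^sup>2\<close>. This is at most \<open>1 / (4 b)\<close>, hence so
  is \<open>c c\<^sup>*\<close>, and positivity of \<open>c\<^sup>* c + c c\<^sup>*\<close> bounds \<open>(r - 1 / (2 b))\<^sup>2\<close> from above.\<close>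

lemma resolvent_star_mult_bound:
  fixes a r :: "'a::cstar_algebra"
  assumes b: "0 < b" and r: "(star a * a + of_real b) * r = 1" "r * (star a * a + of_real b) = 1"
  shows "norm r \<le> 5 / (4 * b)"
proof -
  define h where "h = star a * a + of_real b"
  have "star h = h" by (simp add: h_def star_add star_mult star_star)
  then have "star r * h = 1" using r(1) by (metis h_def star_mult star_one)
  then have sr: "star r = r"
    using r by (metis h_def mult.assoc mult.right_neutral mult.left_neutral)
  define e where "e = 1 / (4 * b)"
  have e: "0 \<le> e" using b by (simp add: e_def)
  define c where "c = a * r"
  define q where "q = r - of_real (1 / (2 * b))"
  have sq: "star q = q" by (simp add: q_def star_diff sr)
  have "star c * c = r * (h - of_real b) * r"
    by (simp add: c_def h_def star_mult sr mult.assoc)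
  also have "\<dots> = (r * h) * r - r * of_real b * r" by (simp only: algebra_simps)
  also have "\<dots> = r - b *\<^sub>R (r * r)"
    using r by (simp add: h_def mult_of_real_eq_scaleR)
  finally have cc: "star c * c = r - b *\<^sub>R (r * r)" .
  have bq: "b *\<^sub>R (q * q) = of_real e - star c * c"
  proof -
    have "q * q = r * r - (1 / (2 * b)) *\<^sub>R r - (1 / (2 * b)) *\<^sub>R r + of_real (1 / (4 * b\<^sup>2))"
      unfolding q_def left_diff_distrib right_diff_distrib mult_of_real_eq_scaleR of_real_mult_eq_scaleR
      by (simp add: of_real_def power2_eq_square scaleR_diff_right)
    also have "\<dots> = r * r - (1 / b) *\<^sub>R r + of_real (1 / (4 * b\<^sup>2))"
    proof -
      have "(1 / b) *\<^sub>R r = (1 / (2 * b)) *\<^sub>R r + (1 / (2 * b)) *\<^sub>R r"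
        by (simp flip: scaleR_add_left)
      then show ?thesis by simp
    qed
    finally show ?thesis
      using b unfolding cc
      by (simp add: e_def of_real_def scaleR_add_right scaleR_diff_right power2_eq_square)
  qed
  have p1: "cstar_positive (b *\<^sub>R (q * q))"
    using b sq by (intro cstar_positive_scaleR cstar_positive_selfadjoint_square) simp_all
  then have "cstar_positive (of_real e - c * star c)"
    unfolding bq using e by (intro cstar_positive_of_real_minus_commute)
  \<comment> \<open>This sum is \<open>e + star c * c\<close>: a lower bound \<open>- e\<close> for
    \<open>star c * c\<close>, reached without assuming it positive.\<close>
  then have "cstar_positive ((of_real e - c * star c) + (star c * c + c * star c))"
    by (intro cstar_positive_add cstar_positive_commutator_sum)
  also have "(of_real e - c * star c) + (star c * c + c * star c) = of_real (2 * e) - b *\<^sub>R (q * q)"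
    unfolding bq mult_2[of e] of_real_add by simp
  finally have "norm (b *\<^sub>R (q * q)) \<le> norm (of_real (2 * e) :: 'a)"
    by (rule cstar_positive_norm_mono[OF p1])
  then have "b * (norm q)\<^sup>2 \<le> 2 * e"
    using norm_star_mult[of q] sq b e by (simp del: of_real_mult)
  then have "(norm q)\<^sup>2 \<le> 1 / (2 * b\<^sup>2)"
    using b by (simp add: e_def field_simps power2_eq_square)
  \<comment> \<open>3/4 rounds up the square root of 1/2, leading to the constant 5/4. Any constant
    below 2 would serve for the halving of \<open>b\<close> that follows.\<close>
  also have "\<dots> \<le> (3 / (4 * b))\<^sup>2"
    using b by (simp add: field_simps power2_eq_square)
  finally have "norm q \<le> 3 / (4 * b)"
    by (rule power2_le_imp_le) (use b in simp)
  moreover have "norm r \<le> norm q + 1 / (2 * b)"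
    using norm_triangle_ineq[of q "of_real (1 / (2 * b))"] b
    by (simp add: q_def norm_divide norm_mult)
  moreover have "3 / (4 * b) + 1 / (2 * b) = 5 / (4 * b)" using b by (simp add: field_simps)
  ultimately show ?thesis by simp
qed

text \<open>By the resolvent bound, invertibility of \<open>a\<^sup>* a + b\<close> passes to \<open>a\<^sup>* a + b / 2\<close>; start at a large \<open>b\<close>.\<close>

lemma cstar_positive_star_mult:
  fixes a :: "'a::cstar_algebra"
  shows "cstar_positive (star a * a)"
  unfolding cstar_positive_iff_unit
proof (intro conjI allI impI)
  let ?h = "star a * a"
  show "star ?h = ?h" by (simp add: star_mult star_star)
  have half: "unit_elt (?h + of_real (b / 2))" if b: "b > 0" "unit_elt (?h + of_real b)" for b
  proof -
    obtain r where r: "(?h + of_real b) * r = 1" "r * (?h + of_real b) = 1"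
      using b(2) by (rule unit_eltE)
    have "norm r * norm (of_real (b / 2) :: 'a) \<le> 5 / (4 * b) * (b / 2)"
      unfolding norm_of_real using resolvent_star_mult_bound[OF b(1) r] b
      by (intro mult_mono) simp_all
    also have "\<dots> < 1" using b by simp
    finally have "unit_elt ((?h + of_real b) - of_real (b / 2))"
      by (rule unit_elt_perturb[OF r])
    also have "(?h + of_real b) - of_real (b / 2) = ?h + (of_real (b - b / 2) :: 'a)"
      by (simp only: of_real_diff add_diff_eq)
    also have "b - b / 2 = b / 2" by simp
    finally show ?thesis .
  qed
  fix t :: real assume t: "t > 0"
  have down: "unit_elt (?h + of_real (2 ^ n * t)) \<Longrightarrow> unit_elt (?h + of_real t)" for n
  proof (induction n)
    case (Suc n)
    have "unit_elt (?h + of_real (2 ^ Suc n * t / 2))"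
      using Suc.prems t by (intro half) simp_all
    moreover have "2 ^ Suc n * t / 2 = 2 ^ n * t" by simp
    ultimately show ?case using Suc.IH by metis
  qed simp
  obtain n where "norm ?h / t < 2 ^ n" using real_arch_pow[of 2 "norm ?h / t"] by auto
  then have "norm ?h < 2 ^ n * t" using t by (simp add: field_simps)
  then have "norm ?h < cmod (complex_of_real (- (2 ^ n * t)))"
    unfolding norm_of_real using t by simp
  then have "unit_elt (?h - complex_of_real (- (2 ^ n * t)) *\<^sub>C 1)"
    by (rule unit_elt_minus_scaleC)
  then have "unit_elt (?h + of_real (2 ^ n * t))"
    unfolding scaleC_of_real by simp
  then show "unit_elt (?h + of_real t)" by (rule down)
qed

lemma cstar_positive_mult_star: "cstar_positive (a * star (a :: 'a::cstar_algebra))"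
  using cstar_positive_star_mult[of "star a"] by (simp add: star_star)

section \<open>Positive series and Cauchy--Schwarz in the algebra\<close>

lemma cstar_le_norm_mono:
  fixes a b :: "'a::cstar_algebra"
  assumes "cstar_positive a" "a \<preceq> b"
  shows "norm a \<le> norm b"
  using assms unfolding cstar_le_def by (rule cstar_positive_norm_mono)

text \<open>Lets the Bessel inequality, which concerns the full series, be applied to finite index
  sets.\<close>

lemma suminf_positive_norm_le:
  fixes f :: "nat \<Rightarrow> 'a::cstar_algebra"
  assumes "summable f" "\<And>n. cstar_positive (f n)" "finite I"
  shows "norm (\<Sum>n\<in>I. f n) \<le> norm (suminf f)"
proof (rule cstar_positive_norm_mono)
  show "cstar_positive (\<Sum>n\<in>I. f n)" using assms by (intro cstar_positive_sum)
  obtain N where N: "I \<subseteq> {..<N}"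
    using assms(3) by (meson finite_nat_bounded)
  have "(\<lambda>n. (\<Sum>i<n + N. f i) - (\<Sum>n\<in>I. f n)) \<longlonglongrightarrow> suminf f - (\<Sum>n\<in>I. f n)"
    using summable_LIMSEQ[OF assms(1), THEN LIMSEQ_ignore_initial_segment, of N]
    by (intro tendsto_intros) simp
  moreover have "cstar_positive ((\<Sum>i<n + N. f i) - (\<Sum>n\<in>I. f n))" for n
  proof -
    have "I \<subseteq> {..<n + N}" using N by auto
    then have "(\<Sum>i<n + N. f i) - (\<Sum>n\<in>I. f n) = (\<Sum>i\<in>{..<n + N} - I. f i)"
      by (simp add: sum_diff)
    then show ?thesis using assms by (simp add: cstar_positive_sum)
  qed
  ultimately show "cstar_positive (suminf f - (\<Sum>n\<in>I. f n))" by (rule cstar_positive_limit)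
qed

lemma summable_positive_comparison:
  fixes f g :: "nat \<Rightarrow> 'a::cstar_algebra"
  assumes "summable g" "\<And>n. cstar_positive (f n)" "\<And>n. f n \<preceq> g n"
  shows "summable f" "norm (suminf f) \<le> norm (suminf g)"
proof -
  have le: "norm (\<Sum>n\<in>I. f n) \<le> norm (\<Sum>n\<in>I. g n)" for I
  proof (rule cstar_positive_norm_mono)
    show "cstar_positive (\<Sum>n\<in>I. f n)" using assms by (intro cstar_positive_sum)
    show "cstar_positive ((\<Sum>n\<in>I. g n) - (\<Sum>n\<in>I. f n))"
      unfolding sum_subtractf[symmetric] using assms(3)
      by (intro cstar_positive_sum) (simp add: cstar_le_def)
  qed
  show f: "summable f"
    unfolding summable_Cauchy using assms(1) le unfolding summable_Cauchy by (meson order_le_less_trans)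
  show "norm (suminf f) \<le> norm (suminf g)"
    using LIMSEQ_le[OF tendsto_norm[OF summable_LIMSEQ[OF f]] tendsto_norm[OF summable_LIMSEQ[OF assms(1)]]]
      le by blast
qed

text \<open>The hypothesis is the expansion of \<open>\<langle>x - t c y, x - t c y\<rangle>\<close> with \<open>c = \<langle>x, y\<rangle>\<close>;
  Cauchy--Schwarz follows by taking \<open>t\<close> close to \<open>1 / norm B\<close>.\<close>

lemma cauchy_schwarz_abstract:
  fixes A B c :: "'a::cstar_algebra"
  assumes "\<And>t::real. t \<ge> 0 \<Longrightarrow>
    cstar_positive (A - (2 * t) *\<^sub>R (c * star c) + t\<^sup>2 *\<^sub>R (c * B * star c))"
  shows "(norm c)\<^sup>2 \<le> norm A * norm B"
proof -
  \<comment> \<open>A \<open>b\<close> strictly above \<open>norm B\<close> keeps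
    \<open>1 / b\<close> meaningful when \<open>B = 0\<close>; with \<open>t = 1 / b\<close> the
    quadratic term uses up half of the linear one.\<close>
  have main: "(norm c)\<^sup>2 \<le> norm A * b" if b: "b > norm B" for b
  proof -
    have b0: "b > 0" using b norm_ge_zero[of B] by linarith
    define t where "t = 1 / b"
    have t: "t > 0" using b0 by (simp add: t_def)
    have "norm ((2 * t) *\<^sub>R (c * star c)) \<le> norm (A + t\<^sup>2 *\<^sub>R (c * B * star c))"
      using assms[of t] t
      by (intro cstar_positive_norm_mono cstar_positive_scaleR cstar_positive_mult_star)
        (simp_all add: algebra_simps)
    also have "\<dots> \<le> norm A + t\<^sup>2 * norm (c * B * star c)"
      by (metis norm_triangle_ineq norm_scaleR abs_power2)
    also have "norm (c * B * star c) \<le> norm c * norm B * norm c"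
      using norm_mult_ineq[of "c * B" "star c"] norm_mult_ineq[of c B]
      by (smt (verit) mult_right_mono norm_ge_zero norm_star)
    also have "\<dots> \<le> b * (norm c)\<^sup>2"
      using mult_right_mono[of "norm B" b "(norm c)\<^sup>2"] b by (simp add: power2_eq_square algebra_simps)
    finally have "2 * t * (norm c)\<^sup>2 \<le> norm A + t\<^sup>2 * (b * (norm c)\<^sup>2)"
      using t by (simp add: norm_mult_star mult_left_mono)
    also have "t\<^sup>2 * (b * (norm c)\<^sup>2) = t * (norm c)\<^sup>2"
      using b0 by (simp add: t_def power2_eq_square)
    finally have "t * (norm c)\<^sup>2 \<le> norm A" by simp
    then show ?thesis using b0 by (simp add: t_def field_simps)
  qed
  have "(\<lambda>n. norm A * (norm B + 1 / real (Suc n))) \<longlonglongrightarrow> norm A * (norm B + 0)"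
    by (intro tendsto_intros LIMSEQ_Suc[OF lim_1_over_n])
  moreover have "(norm c)\<^sup>2 \<le> norm A * (norm B + 1 / real (Suc n))" for n
    by (intro main) simp
  ultimately show ?thesis using LIMSEQ_le_const by fastforce
qed

lemma cauchy_schwarz_sum:
  fixes a b :: "'i \<Rightarrow> 'a::cstar_algebra"
  shows "(norm (\<Sum>i\<in>I. a i * star (b i)))\<^sup>2
    \<le> norm (\<Sum>i\<in>I. a i * star (a i)) * norm (\<Sum>i\<in>I. b i * star (b i))"
proof (rule cauchy_schwarz_abstract)
  fix t :: real
  define c where "c = (\<Sum>i\<in>I. a i * star (b i))"
  have sc: "star c = (\<Sum>i\<in>I. b i * star (a i))"
    by (simp add: c_def star_sum star_mult star_star)
  have "cstar_positive (\<Sum>i\<in>I. (a i - t *\<^sub>R (c * b i)) * star (a i - t *\<^sub>R (c * b i)))"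
    by (intro cstar_positive_sum cstar_positive_mult_star)
  also have "(\<Sum>i\<in>I. (a i - t *\<^sub>R (c * b i)) * star (a i - t *\<^sub>R (c * b i)))
    = (\<Sum>i\<in>I. a i * star (a i)) - t *\<^sub>R (\<Sum>i\<in>I. a i * star (b i)) * star c
      - t *\<^sub>R c * (\<Sum>i\<in>I. b i * star (a i)) + t\<^sup>2 *\<^sub>R (c * (\<Sum>i\<in>I. b i * star (b i)) * star c)"
    by (simp add: star_diff star_scaleR star_mult algebra_simps sum.distrib sum_subtractf
      sum_distrib_left sum_distrib_right scaleR_sum_right power2_eq_square)
  also have "\<dots> = (\<Sum>i\<in>I. a i * star (a i)) - (2 * t) *\<^sub>R (c * star c)
      + t\<^sup>2 *\<^sub>R (c * (\<Sum>i\<in>I. b i * star (b i)) * star c)"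
    unfolding sc[symmetric] c_def[symmetric] by (simp add: algebra_simps flip: scaleR_2)
  finally show "cstar_positive ((\<Sum>i\<in>I. a i * star (a i)) - (2 * t) *\<^sub>R (c * star c)
      + t\<^sup>2 *\<^sub>R (c * (\<Sum>i\<in>I. b i * star (b i)) * star c))" .
qed

subsection \<open>Operators near the identity and Cauchy--Schwarz for forms\<close>

text \<open>A solution of \<open>M x = y\<close> is a fixed point of the contraction sending
  \<open>x\<close> to \<open>y + (x - M x)\<close>. The lower bound \<open>(1 - q) * norm x\<close>
  gives injectivity and bounds the inverse.\<close>

lemma invertible_operator_near_identity:
  fixes M :: "'e::banach \<Rightarrow> 'e"
  assumes "linear M" "q < 1" "\<And>x. norm (M x - x) \<le> q * norm x"
  shows "invertible_operator M"
proof -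
  interpret linear M by fact
  have lower: "(1 - q) * norm x \<le> norm (M x)" for x
    using assms(3)[of x] norm_triangle_sub[of x "M x"] by (simp add: norm_minus_commute algebra_simps)
  have "inj M"
  proof (rule injI)
    fix x y assume "M x = M y"
    then have "(1 - q) * norm (x - y) \<le> 0" using lower[of "x - y"] by (simp add: diff)
    then show "x = y" using assms(2) by (simp add: mult_le_0_iff)
  qed
  moreover have "surj M"
  proof (rule surjI)
    fix y
    define f where "f x = y + (x - M x)" for x
    \<comment> \<open>The fixed point theorem wants a nonnegative constant, but on the zero space
      the hypotheses admit a negative \<open>q\<close>.\<close>
    have "dist (f u) (f v) \<le> max q 0 * dist u v" for u v
    proof -
      have "dist (f u) (f v) = norm (M (u - v) - (u - v))"
        by (simp add: f_def dist_norm diff norm_minus_commute algebra_simps)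
      also have "\<dots> \<le> q * norm (u - v)" by (rule assms(3))
      also have "\<dots> \<le> max q 0 * dist u v" by (simp add: dist_norm mult_right_mono)
      finally show ?thesis .
    qed
    then have "\<exists>!x. f x = x"
      using assms(2) by (intro banach_fix_type[of "max q 0"]) auto
    then have "\<exists>x. M x = y" by (auto simp: f_def)
    then show "M (SOME x. M x = y) = y" by (rule someI_ex)
  qed
  ultimately have bij: "bij M" by (simp add: bij_def)
  then have M_inv: "M (inv M y) = y" and inv_M: "inv M (M x) = x" for x y
    by (simp_all add: bij_is_surj surj_f_inv_f bij_is_inj)
  have "bounded_linear (inv M)"
  proof (rule bounded_linear_intro[where K = "1 / (1 - q)"])
    show "inv M (x + y) = inv M x + inv M y" for x y
      by (metis M_inv inv_M add)
    show "inv M (r *\<^sub>R x) = r *\<^sub>R inv M x" for r x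
      by (metis M_inv inv_M scale)
    show "norm (inv M x) \<le> norm x * (1 / (1 - q))" for x
      using lower[of "inv M x"] assms(2) by (simp add: M_inv field_simps)
  qed
  then show ?thesis using bij by (simp add: invertible_operator_def)
qed

text \<open>Applied to two forms: the inner product, and the form of a positive operator in
  \<open>bij_frame_op\<close>.\<close>

lemma form_cauchy_schwarz:
  fixes B :: "'e::ab_group_add \<Rightarrow> 'e \<Rightarrow> 'a::cstar_algebra" and act :: "'a \<Rightarrow> 'e \<Rightarrow> 'e"
  assumes diff: "\<And>x y z. B (x - y) z = B x z - B y z"
    and act: "\<And>a x y. B (act a x) y = a * B x y"
    and star: "\<And>x y. star (B x y) = B y x"
    and pos: "\<And>x. cstar_positive (B x x)"
  shows "(norm (B x y))\<^sup>2 \<le> norm (B x x) * norm (B y y)"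
proof (rule cauchy_schwarz_abstract)
  fix t :: real
  define c where "c = B x y"
  have diff': "B z (x - y) = B z x - B z y" for x y z
    by (metis diff star star_diff)
  have act': "B x (act a y) = B x y * star a" for a x y
    by (metis act star star_mult)
  have c': "B y x = star c" by (simp add: c_def star)
  have "cstar_positive (B (x - act (t *\<^sub>R c) y) (x - act (t *\<^sub>R c) y))" by (rule pos)
  also have "B (x - act (t *\<^sub>R c) y) (x - act (t *\<^sub>R c) y)
    = B x x - (2 * t) *\<^sub>R (c * star c) + t\<^sup>2 *\<^sub>R (c * B y y * star c)"
    unfolding diff diff' act act' c_def[symmetric] c'
    by (simp add: star_scaleR power2_eq_square algebra_simps
      flip: scaleR_2)
  finally show "cstar_positive (B x x - (2 * t) *\<^sub>R (B x y * star (B x y))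
      + t\<^sup>2 *\<^sub>R (B x y * B y y * star (B x y)))"
    unfolding c_def .
qed

subsection \<open>Square-summable sequences\<close>

lemma l2_norm_nonneg [simp]: "0 \<le> l2_norm a"
  by (simp add: l2_norm_def)

lemma l2_norm_power2: "(l2_norm a)\<^sup>2 = norm (\<Sum>n. a n * star (a n))"
  by (simp add: l2_norm_def l2_ip_def)

text \<open>Parallelogram identity: the defect in the termwise comparison is
  \<open>(a n + b n) * star (a n + b n)\<close>. The factor 2 is harmless, as the estimate serves
  only to show that \<open>U - I\<close> is bounded.\<close>

lemma l2_diff:
  assumes "a \<in> l2" "b \<in> l2"
  shows "(\<lambda>n. a n - b n) \<in> l2"
    and "(l2_norm (\<lambda>n. a n - b n))\<^sup>2 \<le> 2 * ((l2_norm a)\<^sup>2 + (l2_norm b)\<^sup>2)"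
proof -
  let ?f = "\<lambda>n. (a n - b n) * star (a n - b n)"
  let ?g = "\<lambda>n. 2 *\<^sub>R (a n * star (a n) + b n * star (b n))"
  have sa: "summable (\<lambda>n. a n * star (a n))" and sb: "summable (\<lambda>n. b n * star (b n))"
    using assms by (simp_all add: l2_def)
  have g: "summable ?g" by (intro summable_scaleR_right summable_add sa sb)
  have pos: "cstar_positive (?f n)" for n by (rule cstar_positive_mult_star)
  have le: "?f n \<preceq> ?g n" for n
  proof -
    have "?g n - ?f n = (a n + b n) * star (a n + b n)"
      by (simp add: star_add star_diff algebra_simps scaleR_2)
    then show ?thesis unfolding cstar_le_def by (metis cstar_positive_mult_star)
  qed
  show "(\<lambda>n. a n - b n) \<in> l2"
    using summable_positive_comparison(1)[OF g pos le] by (simp add: l2_def)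
  have "(l2_norm (\<lambda>n. a n - b n))\<^sup>2 \<le> norm (suminf ?g)"
    unfolding l2_norm_power2 by (rule summable_positive_comparison(2)[OF g pos le])
  also have "suminf ?g = 2 *\<^sub>R ((\<Sum>n. a n * star (a n)) + (\<Sum>n. b n * star (b n)))"
    using suminf_scaleR_right[OF summable_add[OF sa sb], of 2] suminf_add[OF sa sb] by simp
  also have "norm \<dots> \<le> 2 * ((l2_norm a)\<^sup>2 + (l2_norm b)\<^sup>2)"
    unfolding l2_norm_power2
    using norm_triangle_ineq[of "\<Sum>n. a n * star (a n)" "\<Sum>n. b n * star (b n)"] by simp
  finally show "(l2_norm (\<lambda>n. a n - b n))\<^sup>2 \<le> 2 * ((l2_norm a)\<^sup>2 + (l2_norm b)\<^sup>2)" .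
qed

lemma l2_scaleR:
  assumes "a \<in> l2"
  shows "(\<lambda>n. r *\<^sub>R a n) \<in> l2" and "l2_norm (\<lambda>n. r *\<^sub>R a n) = \<bar>r\<bar> * l2_norm a"
proof -
  have s: "summable (\<lambda>n. a n * star (a n))" using assms by (simp add: l2_def)
  have eq: "(\<lambda>n. r *\<^sub>R a n * star (r *\<^sub>R a n)) = (\<lambda>n. r\<^sup>2 *\<^sub>R (a n * star (a n)))"
    by (simp add: star_scaleR power2_eq_square)
  show "(\<lambda>n. r *\<^sub>R a n) \<in> l2"
    unfolding l2_def mem_Collect_eq eq by (intro summable_scaleR_right s)
  have "(l2_norm (\<lambda>n. r *\<^sub>R a n))\<^sup>2 = (\<bar>r\<bar> * l2_norm a)\<^sup>2"
    unfolding l2_norm_power2 power_mult_distrib eq by (simp flip: suminf_scaleR_right[OF s])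
  then show "l2_norm (\<lambda>n. r *\<^sub>R a n) = \<bar>r\<bar> * l2_norm a"
    by (rule power2_eq_imp_eq) simp_all
qed

lemma zero_in_l2 [simp]: "(\<lambda>n. 0) \<in> l2"
  by (simp add: l2_def)

lemma l2_norm_zero [simp]: "l2_norm (\<lambda>n. 0) = 0"
  by (simp add: l2_norm_def l2_ip_def)

text \<open>The bound \<open>K\<close> makes the supremum in \<open>l2_onorm\<close> one over a
  bounded set and settles sequences of norm 0. The hypotheses are kept weak enough to cover both
  \<open>U\<close> and \<open>U - I\<close>.\<close>

lemma l2_norm_le_onorm:
  fixes V :: "(nat \<Rightarrow> 'a::cstar_algebra) \<Rightarrow> nat \<Rightarrow> 'a"
  assumes scale: "\<And>r a. a \<in> l2 \<Longrightarrow> V (\<lambda>n. r *\<^sub>R a n) = (\<lambda>n. r *\<^sub>R V a n)"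
    and l2: "\<And>a. a \<in> l2 \<Longrightarrow> V a \<in> l2"
    and bound: "\<And>a. a \<in> l2 \<Longrightarrow> l2_norm (V a) \<le> K * l2_norm a"
  shows "a \<in> l2 \<Longrightarrow> l2_norm (V a) \<le> l2_onorm V * l2_norm a" and "0 \<le> l2_onorm V"
proof -
  have bdd: "bdd_above ((\<lambda>a. l2_norm (V a)) ` {a \<in> l2. l2_norm a \<le> 1})"
  proof (rule bdd_aboveI2)
    fix a :: "nat \<Rightarrow> 'a" assume "a \<in> {a \<in> l2. l2_norm a \<le> 1}"
    then show "l2_norm (V a) \<le> \<bar>K\<bar>"
      using bound[of a] mult_mono[OF abs_ge_self[of K], of "l2_norm a" 1] by simp
  qed
  have upper: "l2_norm (V a) \<le> l2_onorm V" if "a \<in> l2" "l2_norm a \<le> 1" for a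
    unfolding l2_onorm_def using that by (intro cSUP_upper bdd) simp
  show "0 \<le> l2_onorm V"
    using upper[of "\<lambda>n. 0"] order_trans[OF l2_norm_nonneg] by simp
  assume a: "a \<in> l2"
  show "l2_norm (V a) \<le> l2_onorm V * l2_norm a"
  proof (cases "l2_norm a = 0")
    case True
    then show ?thesis using bound[OF a] by simp
  next
    case False
    then have pos: "l2_norm a > 0" using l2_norm_nonneg[of a] by linarith
    have "l2_norm (V (\<lambda>n. (1 / l2_norm a) *\<^sub>R a n)) \<le> l2_onorm V"
      using a pos by (intro upper) (simp_all add: l2_scaleR)
    then show ?thesis
      unfolding scale[OF a] using pos by (simp add: l2_scaleR l2[OF a] field_simps)
  qed
qed

subsection \<open>Bessel sequences, frames and multipliers\<close>

context hilbert_module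
begin

lemma act_scaleR: "act (r *\<^sub>R a) x = r *\<^sub>R act a x"
  using act_act[of "r *\<^sub>R 1" a x] act_scaleR_one by simp

lemma act_diff_left: "act (a - b) x = act a x - act b x"
  using act_add_left[of "a - b" b x] by simp

lemma ip_diff_left: "ip (x - y) z = ip x z - ip y z"
  using ip_add_left[of "x - y" y z] by simp

lemma ip_diff_right: "ip x (y - z) = ip x y - ip x z"
  by (metis ip_diff_left ip_star star_diff)

lemma ip_scaleR_left: "ip (r *\<^sub>R x) y = r *\<^sub>R ip x y"
  using ip_act_left[of "r *\<^sub>R 1" x y] act_scaleR_one by simp

lemma norm_ip_self: "norm (ip x x) = (norm x)\<^sup>2"
  by (simp add: norm_eq_sqrt_ip)

lemma norm_ip_le: "norm (ip x y) \<le> norm x * norm y"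
proof (rule power2_le_imp_le)
  show "(norm (ip x y))\<^sup>2 \<le> (norm x * norm y)\<^sup>2"
    unfolding power_mult_distrib norm_ip_self[symmetric]
    by (rule form_cauchy_schwarz[of ip act, OF ip_diff_left ip_act_left ip_star ip_positive])
qed simp

lemma bounded_linear_ip_left: "bounded_linear (\<lambda>x. ip x y)"
  by (rule bounded_linear_intro[where K = "norm y"])
    (simp_all add: ip_add_left ip_scaleR_left norm_ip_le)

lemma ip_eqI:
  assumes "\<And>z. ip x z = ip y z"
  shows "x = y"
proof -
  have "ip (x - y) (x - y) = 0" by (simp add: ip_diff_left assms)
  then have "x - y = 0" by (rule ip_definite)
  then show ?thesis by simp
qed

end

section \<open>Synthesis and frame operator of a Bessel sequence\<close>

locale bessel_sequence = hilbert_module act ip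
  for act :: "'a::cstar_algebra \<Rightarrow> 'e::banach \<Rightarrow> 'e" and ip +
  fixes Y :: "nat \<Rightarrow> 'e" and D :: real
  assumes summable_bessel: "summable (\<lambda>n. ip x (Y n) * ip (Y n) x)"
    and upper: "upper_frame_constant ip Y D"
begin

lemma D_pos: "D > 0"
  using upper by (simp add: upper_frame_constant_def)

lemma bessel_term_positive: "cstar_positive (ip x (Y n) * ip (Y n) x)"
  using cstar_positive_mult_star[of "ip x (Y n)"] by (simp add: ip_star)

lemma suminf_bessel_positive: "cstar_positive (\<Sum>n. ip x (Y n) * ip (Y n) x)"
  by (rule cstar_positive_limit[OF summable_LIMSEQ[OF summable_bessel]])
    (intro cstar_positive_sum bessel_term_positive)

lemma bessel_norm_le: "norm (\<Sum>n. ip x (Y n) * ip (Y n) x) \<le> D * (norm x)\<^sup>2"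
  using cstar_le_norm_mono[OF suminf_bessel_positive[of x], of "D *\<^sub>R ip x x"] upper D_pos
  by (simp add: upper_frame_constant_def norm_ip_self)

lemma analysis_in_l2: "analysis_op ip Y x \<in> l2"
  using summable_bessel[of x] by (simp add: l2_def analysis_op_def ip_star)

text \<open>Duality: \<open>ip z z\<close> is the pairing of the coefficients with those of
  \<open>z\<close>, so Cauchy--Schwarz and the Bessel bound leave a factor
  \<open>(norm z) ^ 2\<close> to cancel. Finite sums come first because this estimate is also the
  Cauchy criterion for the synthesis series.\<close>

lemma norm_synthesis_sum_le:
  assumes "finite I"
  shows "(norm (\<Sum>n\<in>I. act (a n) (Y n)))\<^sup>2 \<le> D * norm (\<Sum>n\<in>I. a n * star (a n))"
proof -
  define z where "z = (\<Sum>n\<in>I. act (a n) (Y n))"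
  have "ip z z = (\<Sum>n\<in>I. ip (act (a n) (Y n)) z)"
    unfolding z_def by (rule linear_sum[OF bounded_linear.linear[OF bounded_linear_ip_left]])
  also have "\<dots> = (\<Sum>n\<in>I. a n * star (ip z (Y n)))"
    by (simp add: ip_act_left ip_star)
  finally have "((norm z)\<^sup>2)\<^sup>2
    \<le> norm (\<Sum>n\<in>I. a n * star (a n)) * norm (\<Sum>n\<in>I. ip z (Y n) * star (ip z (Y n)))"
    unfolding norm_ip_self[symmetric] by (simp only: cauchy_schwarz_sum)
  also have "\<dots> \<le> norm (\<Sum>n\<in>I. a n * star (a n)) * (D * (norm z)\<^sup>2)"
    using suminf_positive_norm_le[OF summable_bessel[of z] bessel_term_positive assms] bessel_norm_le[of z]
    by (intro mult_left_mono) (simp_all add: ip_star)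
  finally have "(norm z)\<^sup>2 * (norm z)\<^sup>2 \<le> (D * norm (\<Sum>n\<in>I. a n * star (a n))) * (norm z)\<^sup>2"
    by (simp add: power2_eq_square mult.commute mult.left_commute)
  then have "z = 0 \<or> (norm z)\<^sup>2 \<le> D * norm (\<Sum>n\<in>I. a n * star (a n))"
    by (simp only: mult_le_cancel_right) auto
  then show ?thesis
    unfolding z_def[symmetric] using D_pos by auto
qed

lemma summable_synthesis:
  assumes "a \<in> l2"
  shows "summable (\<lambda>n. act (a n) (Y n))"
  unfolding summable_Cauchy
proof (intro allI impI)
  fix e :: real assume e: "e > 0"
  have "summable (\<lambda>n. a n * star (a n))" using assms by (simp add: l2_def)
  moreover have "e\<^sup>2 / D > 0" using e D_pos by simp
  ultimately obtain N where N: "\<And>m n. m \<ge> N \<Longrightarrow> norm (\<Sum>n = m..<n. a n * star (a n)) < e\<^sup>2 / D"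
    unfolding summable_Cauchy by meson
  have "norm (\<Sum>n = m..<n. act (a n) (Y n)) < e" if "m \<ge> N" for m n
  proof (rule power2_less_imp_less)
    have "D * norm (\<Sum>n = m..<n. a n * star (a n)) < e\<^sup>2"
      using N[OF that, of n] D_pos by (simp add: field_simps)
    then show "(norm (\<Sum>n = m..<n. act (a n) (Y n)))\<^sup>2 < e\<^sup>2"
      using norm_synthesis_sum_le[of "{m..<n}" a] by simp
  qed (use e in simp)
  then show "\<exists>N. \<forall>m\<ge>N. \<forall>n. norm (\<Sum>n = m..<n. act (a n) (Y n)) < e" by blast
qed

lemma norm_synthesis_le:
  assumes "a \<in> l2"
  shows "norm (synthesis_op act Y a) \<le> sqrt D * l2_norm a"
proof (rule power2_le_imp_le)
  have s: "summable (\<lambda>n. a n * star (a n))" using assms by (simp add: l2_def)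
  have "(\<lambda>N. (norm (\<Sum>n<N. act (a n) (Y n)))\<^sup>2) \<longlonglongrightarrow> (norm (synthesis_op act Y a))\<^sup>2"
    unfolding synthesis_op_def by (intro tendsto_intros summable_LIMSEQ summable_synthesis assms)
  moreover have "(\<lambda>N. D * norm (\<Sum>n<N. a n * star (a n))) \<longlonglongrightarrow> D * norm (\<Sum>n. a n * star (a n))"
    by (intro tendsto_intros summable_LIMSEQ s)
  ultimately have "(norm (synthesis_op act Y a))\<^sup>2 \<le> D * norm (\<Sum>n. a n * star (a n))"
    by (rule LIMSEQ_le) (simp add: norm_synthesis_sum_le)
  then show "(norm (synthesis_op act Y a))\<^sup>2 \<le> (sqrt D * l2_norm a)\<^sup>2"
    using D_pos by (simp add: power_mult_distrib l2_norm_power2)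
qed (use D_pos in simp)

lemma synthesis_diff:
  assumes "a \<in> l2" "b \<in> l2"
  shows "synthesis_op act Y (\<lambda>n. a n - b n) = synthesis_op act Y a - synthesis_op act Y b"
  unfolding synthesis_op_def act_diff_left by (intro suminf_diff[symmetric] summable_synthesis assms)

lemma synthesis_add:
  assumes "a \<in> l2" "b \<in> l2"
  shows "synthesis_op act Y (\<lambda>n. a n + b n) = synthesis_op act Y a + synthesis_op act Y b"
  unfolding synthesis_op_def act_add_left by (intro suminf_add[symmetric] summable_synthesis assms)

lemma synthesis_scaleR:
  assumes "a \<in> l2"
  shows "synthesis_op act Y (\<lambda>n. r *\<^sub>R a n) = r *\<^sub>R synthesis_op act Y a"
  unfolding synthesis_op_def act_scaleR by (intro suminf_scaleR_right[symmetric] summable_synthesis assms)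

lemma ip_synthesis:
  assumes "a \<in> l2"
  shows "ip (synthesis_op act Y a) z = (\<Sum>n. a n * ip (Y n) z)"
  unfolding synthesis_op_def
  using bounded_linear.suminf[OF bounded_linear_ip_left summable_synthesis[OF assms], of z]
  by (simp add: ip_act_left)

lemma summable_ip_synthesis:
  assumes "a \<in> l2"
  shows "summable (\<lambda>n. a n * ip (Y n) z)"
  using bounded_linear.summable[OF bounded_linear_ip_left summable_synthesis[OF assms], of z]
  by (simp add: ip_act_left)

abbreviation S where "S \<equiv> frame_op act ip Y"

text \<open>Tested against \<open>z\<close>, identities for \<open>S\<close> become identities of
  convergent series in the algebra; \<open>ip_eqI\<close> carries them back.\<close>

lemma ip_frame_op: "ip (S x) z = (\<Sum>n. ip x (Y n) * ip (Y n) z)"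
  using ip_synthesis[OF analysis_in_l2] by (simp add: frame_op_def analysis_op_def)

lemma summable_ip_frame_op: "summable (\<lambda>n. ip x (Y n) * ip (Y n) z)"
  using summable_ip_synthesis[OF analysis_in_l2] by (simp add: analysis_op_def)

lemma ip_frame_op_commute: "ip (S x) z = ip x (S z)"
proof -
  have "ip x (S z) = star (\<Sum>n. ip z (Y n) * ip (Y n) x)" by (simp add: ip_frame_op flip: ip_star[of "S z"])
  also have "\<dots> = (\<Sum>n. star (ip z (Y n) * ip (Y n) x))"
    by (rule bounded_linear.suminf[OF bounded_linear_star summable_ip_frame_op])
  also have "\<dots> = ip (S x) z" by (simp add: star_mult ip_star ip_frame_op)
  finally show ?thesis by simp
qed

lemma linear_frame_op: "linear S"
proof (rule linearI)
  show "S (x + y) = S x + S y" for x y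
    by (rule ip_eqI) (simp add: ip_frame_op ip_add_left distrib_right suminf_add summable_ip_frame_op)
  show "S (r *\<^sub>R x) = r *\<^sub>R S x" for r x
    by (rule ip_eqI) (simp add: ip_frame_op ip_scaleR_left suminf_scaleR_right summable_ip_frame_op)
qed

lemma frame_op_act: "S (act a x) = act a (S x)"
  by (rule ip_eqI)
    (simp add: ip_frame_op ip_act_left mult.assoc suminf_mult summable_ip_frame_op)

lemma l2_norm_analysis: "(l2_norm (analysis_op ip Y x))\<^sup>2 = norm (ip (S x) x)"
  unfolding l2_norm_power2 ip_frame_op by (simp add: analysis_op_def ip_star)

end

section \<open>Frames: inverting the frame operator, the canonical dual, multipliers\<close>

locale frame_sequence = bessel_sequence +
  fixes C :: real
  assumes lower: "lower_frame_constant ip Y C"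
begin

lemma C_pos: "C > 0"
  using lower by (simp add: lower_frame_constant_def)

text \<open>Cauchy--Schwarz for the form \<open>\<langle>R x, y\<rangle>\<close> with \<open>R = I - S / (C + D)\<close>, for which
  \<open>0 \<le> \<langle>R x, x\<rangle> \<le> D / (C + D) \<langle>x, x\<rangle>\<close>, makes \<open>R\<close> a contraction. Dividing by \<open>D\<close> instead would not
  work when \<open>C > D\<close>, which happens on the zero module.\<close>

lemma bij_frame_op: "bij S"
proof -
  interpret S: linear S by (rule linear_frame_op)
  define s where "s = 1 / (C + D)"
  have s: "s > 0" using C_pos D_pos by (simp add: s_def)
  define R where "R x = x - s *\<^sub>R S x" for x
  have ip_R: "ip (R x) y = ip x y - s *\<^sub>R ip (S x) y" for x y
    by (simp add: R_def ip_diff_left ip_scaleR_left)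
  have Rx: "ip (R x) x = ip x x - s *\<^sub>R (\<Sum>n. ip x (Y n) * ip (Y n) x)" for x
    by (simp add: ip_R ip_frame_op)
  have R_pos: "cstar_positive (ip (R x) x)" for x
  proof -
    have "cstar_positive (s *\<^sub>R ((D *\<^sub>R ip x x - (\<Sum>n. ip x (Y n) * ip (Y n) x)) + C *\<^sub>R ip x x))"
      using upper s C_pos
      by (intro cstar_positive_scaleR cstar_positive_add ip_positive)
        (simp_all add: upper_frame_constant_def cstar_le_def)
    also have "s *\<^sub>R ((D *\<^sub>R ip x x - (\<Sum>n. ip x (Y n) * ip (Y n) x)) + C *\<^sub>R ip x x)
      = (s * (C + D)) *\<^sub>R ip x x - s *\<^sub>R (\<Sum>n. ip x (Y n) * ip (Y n) x)"
      by (simp add: algebra_simps)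
    also have "s * (C + D) = 1" using C_pos D_pos by (simp add: s_def)
    finally show ?thesis by (simp add: Rx)
  qed
  define q where "q = 1 - s * C"
  have q: "0 \<le> q" "q < 1" using C_pos D_pos by (simp_all add: q_def s_def field_simps)
  have R_le: "norm (ip (R x) x) \<le> q * (norm x)\<^sup>2" for x
  proof -
    have "cstar_positive (s *\<^sub>R ((\<Sum>n. ip x (Y n) * ip (Y n) x) - C *\<^sub>R ip x x))"
      using lower s by (intro cstar_positive_scaleR) (simp_all add: lower_frame_constant_def cstar_le_def)
    also have "s *\<^sub>R ((\<Sum>n. ip x (Y n) * ip (Y n) x) - C *\<^sub>R ip x x) = q *\<^sub>R ip x x - ip (R x) x"
      by (simp add: Rx q_def algebra_simps)
    finally have "norm (ip (R x) x) \<le> norm (q *\<^sub>R ip x x)"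
      by (rule cstar_positive_norm_mono[OF R_pos])
    then show ?thesis using q by (simp add: norm_ip_self)
  qed
  have "norm (R x) \<le> q * norm x" for x
  proof -
    \<comment> \<open>The vectors inserted are \<open>x\<close> and \<open>R x\<close>, so the left
      side is built from \<open>ip (R x) (R x)\<close>. Bounding both factors on the right by
      \<open>R_le\<close> leaves \<open>(norm (R x)) ^ 2\<close> to cancel.\<close>
    have "((norm (R x))\<^sup>2)\<^sup>2 \<le> norm (ip (R x) x) * norm (ip (R (R x)) (R x))"
      unfolding norm_ip_self[symmetric]
    proof (rule form_cauchy_schwarz[of "\<lambda>x. ip (R x)" act])
      show "ip (R (x - y)) z = ip (R x) z - ip (R y) z" for x y z
        by (simp add: ip_R ip_diff_left S.diff algebra_simps)
      show "ip (R (act a x)) y = a * ip (R x) y" for a x y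
        by (simp add: ip_R ip_act_left frame_op_act algebra_simps)
      show "star (ip (R x) y) = ip (R y) x" for x y
        by (simp add: ip_R star_diff star_scaleR ip_star ip_frame_op_commute)
    qed (rule R_pos)
    also have "\<dots> \<le> (q * (norm x)\<^sup>2) * (q * (norm (R x))\<^sup>2)"
      using q by (intro mult_mono R_le) simp_all
    finally have *: "(norm (R x))\<^sup>2 * (norm (R x))\<^sup>2 \<le> (q * norm x)\<^sup>2 * (norm (R x))\<^sup>2"
      by (simp add: power2_eq_square algebra_simps)
    show ?thesis
    proof (cases "R x = 0")
      case False
      then have "(norm (R x))\<^sup>2 \<le> (q * norm x)\<^sup>2" using * by (simp only: mult_le_cancel_right) simp
      then show ?thesis by (rule power2_le_imp_le) (use q in simp)
    qed (use q in simp)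
  qed
  then have "norm (s *\<^sub>R S x - x) \<le> q * norm x" for x
    by (simp add: R_def norm_minus_commute)
  moreover have "linear (\<lambda>x. s *\<^sub>R S x)"
    by (intro linear_compose_scale_right linear_frame_op)
  ultimately have bij: "bij (\<lambda>x. s *\<^sub>R S x)"
    using q(2) invertible_operator_near_identity[of "\<lambda>x. s *\<^sub>R S x" q]
    by (simp add: invertible_operator_def)
  show "bij S"
  proof (rule bijI)
    show "inj S" using bij by (auto simp: bij_def inj_def)
    have "\<exists>x. s *\<^sub>R S x = s *\<^sub>R y" for y using bij by (metis bij_pointE)
    then show "surj S" using s by (metis less_irrefl scaleR_left_imp_eq surj_def)
  qed
qed

lemma frame_op_inv [simp]: "S (inv S x) = x"
  using bij_frame_op by (simp add: bij_is_surj surj_f_inv_f)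

text \<open>Selfadjointness of \<open>S\<close> moves its inverse from the frame vector to
  \<open>x\<close>; the dual analysis operator is therefore that of \<open>Y\<close> after
  \<open>inv S\<close>.\<close>

lemma ip_canonical_dual: "ip x (canonical_dual act ip Y n) = ip (inv S x) (Y n)"
  using ip_frame_op_commute[of "inv S x" "inv S (Y n)"] by (simp add: canonical_dual_def)

lemma analysis_canonical_dual:
  "analysis_op ip (canonical_dual act ip Y) x = analysis_op ip Y (inv S x)"
  by (simp add: analysis_op_def ip_canonical_dual)

lemma synthesis_analysis_canonical_dual:
  "synthesis_op act Y (analysis_op ip (canonical_dual act ip Y) x) = x"
  using frame_op_inv[of x] unfolding analysis_canonical_dual frame_op_def .

text \<open>For \<open>z = inv S x\<close> the squared norm is \<open>norm (ip x z)\<close>, at most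
  \<open>norm x * norm z\<close>. The lower frame inequality at \<open>z\<close> bounds
  \<open>norm z\<close> by \<open>norm x / C\<close>.\<close>

lemma l2_norm_analysis_canonical_dual:
  "l2_norm (analysis_op ip (canonical_dual act ip Y) x) \<le> norm x / sqrt C"
proof (rule power2_le_imp_le)
  define z where "z = inv S x"
  have Sz: "S z = x" by (simp add: z_def)
  have "norm (C *\<^sub>R ip z z) \<le> norm (ip x z)"
    unfolding Sz[symmetric] ip_frame_op
    using lower C_pos
    by (intro cstar_le_norm_mono cstar_positive_scaleR ip_positive) (simp_all add: lower_frame_constant_def)
  also have le: "\<dots> \<le> norm x * norm z" by (rule norm_ip_le)
  finally have "(C * norm z) * norm z \<le> norm x * norm z"
    using C_pos by (simp add: norm_ip_self power2_eq_square)
  then have z: "norm z \<le> norm x / C"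
    using C_pos by (cases "z = 0") (simp_all add: field_simps)
  have "(l2_norm (analysis_op ip (canonical_dual act ip Y) x))\<^sup>2 = norm (ip x z)"
    unfolding analysis_canonical_dual l2_norm_analysis by (simp add: z_def)
  also have "\<dots> \<le> norm x * norm z" by (rule le)
  also have "\<dots> \<le> norm x * (norm x / C)" using z by (intro mult_left_mono) simp_all
  also have "\<dots> = (norm x / sqrt C)\<^sup>2" using C_pos by (simp add: power2_eq_square)
  finally show "(l2_norm (analysis_op ip (canonical_dual act ip Y) x))\<^sup>2 \<le> (norm x / sqrt C)\<^sup>2" .
qed (use C_pos in simp)

text \<open>The numbers \<open>u\<close> and \<open>v\<close> stand for bounds of \<open>U\<close>
  and \<open>U - I\<close>, so that both parts of the theorem are instances.\<close>

lemma invertible_multiplier: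
  assumes X: "bessel_sequence act ip X DX"
    and summable: "summable (\<lambda>n. (norm (X n - canonical_dual act ip Y n))\<^sup>2)"
    and U_l2: "\<And>a. a \<in> l2 \<Longrightarrow> U a \<in> l2"
    and U_add: "\<And>a b. a \<in> l2 \<Longrightarrow> b \<in> l2 \<Longrightarrow> U (\<lambda>n. a n + b n) = (\<lambda>n. U a n + U b n)"
    and U_scaleR: "\<And>r a. a \<in> l2 \<Longrightarrow> U (\<lambda>n. r *\<^sub>R a n) = (\<lambda>n. r *\<^sub>R U a n)"
    and u: "\<And>a. a \<in> l2 \<Longrightarrow> l2_norm (U a) \<le> u * l2_norm a" "0 \<le> u"
    and v: "\<And>a. a \<in> l2 \<Longrightarrow> l2_norm (\<lambda>n. U a n - a n) \<le> v * l2_norm a" "0 \<le> v"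
    and small: "sqrt D * (u * sqrt (\<Sum>n. (norm (X n - canonical_dual act ip Y n))\<^sup>2) + v / sqrt C) < 1"
  shows "invertible_operator (multiplier act ip U Y X)"
proof (rule invertible_operator_near_identity[OF _ small])
  interpret X: bessel_sequence act ip X DX by fact
  let ?W = "canonical_dual act ip Y"
  let ?M = "multiplier act ip U Y X"
  have M: "?M x = synthesis_op act Y (U (analysis_op ip X x))" for x
    by (simp add: multiplier_def)
  show "linear ?M"
  proof (rule linearI)
    fix x y and r :: real
    have "analysis_op ip X (x + y) = (\<lambda>n. analysis_op ip X x n + analysis_op ip X y n)"
      by (simp add: analysis_op_def ip_add_left)
    then show "?M (x + y) = ?M x + ?M y"
      by (simp add: M U_add U_l2 X.analysis_in_l2 synthesis_add)
    have "analysis_op ip X (r *\<^sub>R x) = (\<lambda>n. r *\<^sub>R analysis_op ip X x n)"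
      by (simp add: analysis_op_def ip_scaleR_left)
    then show "?M (r *\<^sub>R x) = r *\<^sub>R ?M x"
      by (simp add: M U_scaleR U_l2 X.analysis_in_l2 synthesis_scaleR)
  qed
  fix x
  define s where "s = (\<Sum>n. (norm (X n - ?W n))\<^sup>2)"
  define a where "a = analysis_op ip ?W x"
  define d where "d = (\<lambda>n. analysis_op ip X x n - a n)"
  have a: "a \<in> l2" unfolding a_def analysis_canonical_dual by (rule analysis_in_l2)
  have d: "d \<in> l2" unfolding d_def by (intro l2_diff X.analysis_in_l2 a)
  have d_eq: "d n = ip x (X n - ?W n)" for n
    by (simp add: d_def a_def analysis_op_def ip_diff_right)
  have s0: "0 \<le> s" unfolding s_def by (intro suminf_nonneg summable) simp
  have l2d: "l2_norm d \<le> sqrt s * norm x"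
  proof (rule power2_le_imp_le)
    \<comment> \<open>Cauchy--Schwarz in each coordinate; the norm of the algebra-valued series is
      then at most the sum of the norms, which brings in the scalar series of squared
      distances.\<close>
    have bound: "norm (d n * star (d n)) \<le> (norm (X n - ?W n))\<^sup>2 * (norm x)\<^sup>2" for n
      unfolding norm_mult_star d_eq power_mult_distrib[symmetric]
      by (intro power_mono) (simp_all add: norm_ip_le mult.commute)
    have sm: "summable (\<lambda>n. (norm (X n - ?W n))\<^sup>2 * (norm x)\<^sup>2)"
      by (intro summable_mult2 summable)
    have "(l2_norm d)\<^sup>2 \<le> (\<Sum>n. (norm (X n - ?W n))\<^sup>2 * (norm x)\<^sup>2)"
      unfolding l2_norm_power2 by (rule norm_suminf_le[OF bound sm])
    also have "\<dots> = s * (norm x)\<^sup>2" unfolding s_def by (rule suminf_mult2[OF summable, symmetric])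
    also have "\<dots> = (sqrt s * norm x)\<^sup>2" using s0 by (simp add: power_mult_distrib)
    finally show "(l2_norm d)\<^sup>2 \<le> (sqrt s * norm x)\<^sup>2" .
  qed (use s0 in simp)
  have l2a: "l2_norm a \<le> norm x / sqrt C"
    unfolding a_def by (rule l2_norm_analysis_canonical_dual)
  have Ua: "(\<lambda>n. U a n - a n) \<in> l2" by (intro l2_diff U_l2 a)
  have "analysis_op ip X x = (\<lambda>n. d n + a n)" by (simp add: d_def)
  then have "?M x - x = synthesis_op act Y (U d) + synthesis_op act Y (U a) - synthesis_op act Y a"
    by (simp add: M U_add U_l2 a d synthesis_add) (simp add: a_def synthesis_analysis_canonical_dual)
  also have "\<dots> = synthesis_op act Y (U d) + synthesis_op act Y (\<lambda>n. U a n - a n)"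
    by (simp add: synthesis_diff U_l2 a)
  also have "norm \<dots> \<le> sqrt D * l2_norm (U d) + sqrt D * l2_norm (\<lambda>n. U a n - a n)"
    by (intro norm_triangle_le add_mono norm_synthesis_le U_l2 d Ua)
  also have "\<dots> \<le> sqrt D * (u * (sqrt s * norm x)) + sqrt D * (v * (norm x / sqrt C))"
    using u(1)[OF d] v(1)[OF a] mult_left_mono[OF l2d u(2)] mult_left_mono[OF l2a v(2)] D_pos
    by (intro add_mono mult_left_mono) simp_all
  also have "\<dots> = sqrt D * (u * sqrt s + v / sqrt C) * norm x"
    by (simp add: algebra_simps)
  finally show "norm (?M x - x) \<le> sqrt D * (u * sqrt (\<Sum>n. (norm (X n - ?W n))\<^sup>2) + v / sqrt C) * norm x"
    unfolding s_def .
qed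

end

theorem proposition3p9:
  fixes act :: "'a::cstar_algebra \<Rightarrow> 'e::banach \<Rightarrow> 'e"
    and ip :: "'e \<Rightarrow> 'e \<Rightarrow> 'a"
    and Y :: "nat \<Rightarrow> 'e"
    and C D :: real
  assumes "hilbert_module act ip"
    and "finitely_generated act \<or> countably_generated act"
    and "standard_frame ip Y"
    and "frame_bounds ip Y C D"
  shows "(\<forall>X. standard_bessel ip X \<and>
            summable (\<lambda>n. (norm (X n - canonical_dual act ip Y n))\<^sup>2) \<and>
            (\<Sum>n. (norm (X n - canonical_dual act ip Y n))\<^sup>2) < 1 / (4 * D)
            \<longrightarrow> invertible_operator (multiplier act ip id Y X))
       \<and> (\<forall>X U. standard_bessel ip X \<and>
            summable (\<lambda>n. (norm (X n - canonical_dual act ip Y n))\<^sup>2) \<and>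
            (\<Sum>n. (norm (X n - canonical_dual act ip Y n))\<^sup>2) < 1 / (4 * D) \<and>
            l2_bounded_operator U \<and>
            l2_onorm U < 1 \<and>
            l2_onorm (\<lambda>a n. U a n - a n) < sqrt (C / (4 * D))
            \<longrightarrow> invertible_operator (multiplier act ip U Y X))"
proof -
  interpret hilbert_module act ip by fact
  interpret frame_sequence act ip Y D C
    using assms(3,4) by unfold_locales (simp_all add: standard_frame_def frame_bounds_def)
  have bessel: "\<exists>D'. bessel_sequence act ip X D'" if "standard_bessel ip X" for X
    using that hilbert_module_axioms
    by (auto simp: standard_bessel_def bessel_sequence_def bessel_sequence_axioms_def)
  have root: "sqrt D * sqrt t < 1 / 2" if "t < 1 / (4 * D)" for t
  proof -
    have "D * t < 1 / 4" using that D_pos by (simp add: field_simps)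
    then have "sqrt (D * t) < sqrt (1 / 4)" by (rule real_sqrt_less_mono)
    also have "sqrt (1 / 4 :: real) = 1 / 2" by (simp add: real_sqrt_divide)
    finally show ?thesis by (simp add: real_sqrt_mult)
  qed
  show ?thesis
  proof (intro conjI allI impI; elim conjE)
    fix X assume X: "standard_bessel ip X"
      and sm: "summable (\<lambda>n. (norm (X n - canonical_dual act ip Y n))\<^sup>2)"
      and lt: "(\<Sum>n. (norm (X n - canonical_dual act ip Y n))\<^sup>2) < 1 / (4 * D)"
    obtain DX where DX: "bessel_sequence act ip X DX" using bessel[OF X] by blast
    show "invertible_operator (multiplier act ip id Y X)"
      \<comment> \<open>The identity has norm 1 and so escapes the strict bound of the second part;
        with \<open>v = 0\<close> the contraction constant is already below 1/2.\<close>
      by (rule invertible_multiplier[OF DX sm, of id 1 0]) (use root[OF lt] in simp_all)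
  next
    fix X and U :: "(nat \<Rightarrow> 'a) \<Rightarrow> nat \<Rightarrow> 'a"
    assume X: "standard_bessel ip X"
      and sm: "summable (\<lambda>n. (norm (X n - canonical_dual act ip Y n))\<^sup>2)"
      and lt: "(\<Sum>n. (norm (X n - canonical_dual act ip Y n))\<^sup>2) < 1 / (4 * D)"
      and U: "l2_bounded_operator U" and U1: "l2_onorm U < 1"
      and V1: "l2_onorm (\<lambda>a n. U a n - a n) < sqrt (C / (4 * D))"
    obtain DX where DX: "bessel_sequence act ip X DX" using bessel[OF X] by blast
    have U_l2: "U a \<in> l2" if "a \<in> l2" for a
      using U that by (simp add: l2_bounded_operator_def)
    have U_add: "U (\<lambda>n. a n + b n) = (\<lambda>n. U a n + U b n)" if "a \<in> l2" "b \<in> l2" for a b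
      using U that by (simp add: l2_bounded_operator_def)
    have U_scaleR: "U (\<lambda>n. r *\<^sub>R a n) = (\<lambda>n. r *\<^sub>R U a n)" if "a \<in> l2" for r a
    proof -
      have "U (\<lambda>n. complex_of_real r *\<^sub>C a n) = (\<lambda>n. complex_of_real r *\<^sub>C U a n)"
        using U that unfolding l2_bounded_operator_def by blast
      then show ?thesis by (simp add: scaleC_complex_of_real)
    qed
    obtain K where K: "\<And>a. a \<in> l2 \<Longrightarrow> l2_norm (U a) \<le> K * l2_norm a"
      using U unfolding l2_bounded_operator_def by blast
    define V where "V = (\<lambda>a n. U a n - a n)"
    have V_l2: "V a \<in> l2" if "a \<in> l2" for a
      unfolding V_def by (intro l2_diff U_l2 that)
    have V_scaleR: "V (\<lambda>n. r *\<^sub>R a n) = (\<lambda>n. r *\<^sub>R V a n)" if "a \<in> l2" for r a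
      unfolding V_def U_scaleR[OF that] by (simp add: scaleR_diff_right)
    \<comment> \<open>Only finiteness of this constant matters: it makes \<open>l2_onorm V\<close> a
      genuine operator bound.\<close>
    have KV: "l2_norm (V a) \<le> sqrt (2 * (K\<^sup>2 + 1)) * l2_norm a" if a: "a \<in> l2" for a
    proof (rule power2_le_imp_le)
      have "(l2_norm (V a))\<^sup>2 \<le> 2 * ((l2_norm (U a))\<^sup>2 + (l2_norm a)\<^sup>2)"
        unfolding V_def by (intro l2_diff U_l2 a)
      also have "(l2_norm (U a))\<^sup>2 \<le> (K * l2_norm a)\<^sup>2"
        using K[OF a] by (intro power_mono) simp_all
      finally show "(l2_norm (V a))\<^sup>2 \<le> (sqrt (2 * (K\<^sup>2 + 1)) * l2_norm a)\<^sup>2"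
        by (simp add: algebra_simps)
    qed simp
    note u = l2_norm_le_onorm[of U, OF U_scaleR U_l2 K]
    note v = l2_norm_le_onorm[of V, OF V_scaleR V_l2 KV]
    show "invertible_operator (multiplier act ip U Y X)"
    proof (rule invertible_multiplier[OF DX sm U_l2 U_add U_scaleR u v(1)[unfolded V_def] v(2)[unfolded V_def]])
      let ?s = "\<Sum>n. (norm (X n - canonical_dual act ip Y n))\<^sup>2"
      let ?v = "l2_onorm (\<lambda>a n. U a n - a n)"
      have "l2_onorm U * sqrt ?s \<le> 1 * sqrt ?s"
        using U1 by (intro mult_right_mono) (simp_all add: suminf_nonneg sm)
      then have "sqrt D * (l2_onorm U * sqrt ?s) \<le> sqrt D * sqrt ?s"
        using D_pos by (intro mult_left_mono) simp_all
      also have "\<dots> < 1 / 2" by (rule root[OF lt])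
      finally have 1: "sqrt D * (l2_onorm U * sqrt ?s) < 1 / 2" .
      have "sqrt D * ?v < sqrt D * sqrt (C / (4 * D))"
        using V1 D_pos by (intro mult_strict_left_mono) simp_all
      also have "\<dots> = sqrt C / 2"
        using D_pos by (simp add: real_sqrt_divide real_sqrt_mult)
      finally have "sqrt D * (?v / sqrt C) < 1 / 2"
        using C_pos by (simp add: field_simps)
      then show "sqrt D * (l2_onorm U * sqrt ?s + ?v / sqrt C) < 1"
        using 1 unfolding distrib_left by linarith
    qed
  qed
qed

end
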